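(* Let $R$ be an associative ring with identity and pseudo-involution, let $(V,B,\mathfrak L)$ be an odd quadratic space over $R$, and let $\pi:U\to\mathrm{StU}(8,R,\mathfrak L)$ be a universal central extension of the odd unitary Steinberg group $\mathrm{StU}(8,R,\mathfrak L)$ (the case $n=4$). Then the Schur multiplier $\mathrm M(\mathrm{StU}(8,R,\mathfrak L))=\mathrm{Ker}(\pi)$ coincides with the subgroup of $U$ generated by the elements $$[\pi^{-1}X_{ij}(a),\,\pi^{-1}X_{kh}(b)],\qquad i,j,k,h\in\Omega,\ \mathrm{Card}\{\pm i,\pm j,\pm k,\pm h\}=8,\ a,b\in R.$$
   Context: Odd quadratic spaces. A pseudo-involution on an associative ring $R$ with identity is an additive map $\overline{\phantom a}:R\to R$ such that $\overline 1$ is invertible, $\overline{\overline a}=a$ and $\overline{ab}=\overline b\,\overline1^{-1}\overline a$. An anti-Hermitian form on a right $R$-module $V$ is a biadditive map $B:V\times V\to R$ with $B(ua,vb)=\overline a\,\overline1^{-1}B(u,v)b$ and $B(u,v)=-\overline{B(v,u)}$. The Heisenberg group $\mathfrak H$ of $B$ is the set $V\times R$ with group law $(u,a)\dotplus(v,b)=(u+v,\,a+b+B(u,v))$; inverses are $\dot-(u,a)=(-u,-a+B(u,u))$. $R$ acts on $\mathfrak H$ on the right by $(u,a)\leftharpoonup b=(ub,\,\overline b\,\overline1^{-1}ab)$. An odd form parameter is a subgroup $\mathfrak L\leq\mathfrak H$ stable under the action of $R$ with $\mathfrak L_{\min}\leq\mathfrak L\leq\mathfrak L_{\max}$, where $\mathfrak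 L_{\min}=\{(0,a+\overline a)\mid a\in R\}$ and $\mathfrak L_{\max}=\{(u,a)\mid a=\overline a+B(u,u)\}$. The triple $(V,B,\mathfrak L)$ is called an odd quadratic space. Odd unitary Steinberg group. For an integer $n\ge3$ put $\Omega=\{1,\dots,n,-n,\dots,-1\}$, and $\varepsilon_i=\overline1^{-1}$ for $i>0$, $\varepsilon_i=-1$ for $i<0$. Commutators are $[x,y]=xyx^{-1}y^{-1}$. $\mathrm{StU}(2n,R,\mathfrak L)$ is the group with generators $X_{ij}(a)$ ($i,j\in\Omega$, $i\notin\{\pm j\}$, $a\in R$) and $X_i(\xi)$ ($i\in\Omega$, $\xi\in\mathfrak L$), and relations (for all indices and parameters for which the symbols are defined): (R0) $X_{ij}(a)=X_{-j,-i}(\varepsilon_{-j}\overline a\varepsilon_i)$; (R1) $X_{ij}(a)X_{ij}(b)=X_{ij}(a+b)$; (R2) $X_i(\xi)X_i(\zeta)=X_i(\xi\dotplus\zeta)$; (R3) $[X_{ij}(a),X_{hk}(b)]=1$ for $h\notin\{j,-i\}$, $k\notin\{i,-j\}$; (R4) $[X_i(\xi),X_{jk}(a)]=1$ for $j\ne-i$, $k\neq i$; (R5) $[X_{ij}(a),X_{jk}(b)]=X_{ik}(ab)$; (R6) $[X_i(u,a),X_j(v,b)]=X_{i,-j}(\varepsilon_iB(u,v))$ for $i\notin\{\pm j\}$; (R7) $[X_i(u,a),X_i(v,b)]=X_i(0,B(u,v)-B(v,u))$; (R8) $[X_i(u,a),X_{-i,j}(b)]=X_{ij}(\varepsilon_iab)\,X_{-j}((u,-\overline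 a)\leftharpoonup b)$; (R9) $[X_{ij}(a),X_{j,-i}(b)]=X_i(0,-\varepsilon_{-i}\overline1ab+\overline b\,\overline1^{-1}\overline a\varepsilon_i)$. Central extensions. A central extension of a group $G$ is an epimorphism $\epsilon:H\to G$ whose kernel lies in the center of $H$. For $x,y\in G$, $[\epsilon^{-1}x,\epsilon^{-1}y]$ denotes the commutator $[u,v]$ of any $u,v\in H$ with $\epsilon(u)=x$, $\epsilon(v)=y$ (independent of the choice of $u,v$). A central extension $\pi:U\to G$ is universal if for every central extension $\epsilon:H\to G$ there is a unique homomorphism $\eta:U\to H$ with $\epsilon\eta=\pi$. Such $\pi$ exists exactly when $G$ is perfect, and then the Schur multiplier is $\mathrm M(G)=\mathrm{Ker}(\pi)$. The group $\mathrm{StU}(2n,R,\mathfrak L)$ is perfect. *)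

theory Defs
  imports "HOL-Algebra.Algebra"
begin

section \<open>Odd quadratic spaces\<close>

text \<open>
  Rings are types of sort \<open>{ring, monoid_mult}\<close>: associative with identity, not
  necessarily commutative. Unlike the class \<open>ring_1\<close>, this sort does not exclude the zero ring.
\<close>

definition unit_inv :: "'r::monoid_mult \<Rightarrow> 'r" where
  "unit_inv x = (THE y. x * y = 1 \<and> y * x = 1)"

definition pseudo_involution :: "('r::{ring,monoid_mult} \<Rightarrow> 'r) \<Rightarrow> bool" where
  "pseudo_involution bar \<longleftrightarrow>
     (\<forall>a b. bar (a + b) = bar a + bar b) \<and>
     (\<exists>c. bar 1 * c = 1 \<and> c * bar 1 = 1) \<and>
     (\<forall>a. bar (bar a) = a) \<and>
     (\<forall>a b. bar (a * b) = bar b * unit_inv (bar 1) * bar a)"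

definition right_module :: "('v::ab_group_add \<Rightarrow> 'r::{ring,monoid_mult} \<Rightarrow> 'v) \<Rightarrow> bool" where
  "right_module act \<longleftrightarrow>
     (\<forall>u v a. act (u + v) a = act u a + act v a) \<and>
     (\<forall>u a b. act u (a + b) = act u a + act u b) \<and>
     (\<forall>u a b. act u (a * b) = act (act u a) b) \<and>
     (\<forall>u. act u 1 = u)"

definition anti_hermitian_form ::
  "('r::{ring,monoid_mult} \<Rightarrow> 'r) \<Rightarrow> ('v::ab_group_add \<Rightarrow> 'r \<Rightarrow> 'v) \<Rightarrow> ('v \<Rightarrow> 'v \<Rightarrow> 'r) \<Rightarrow> bool" where
  "anti_hermitian_form bar act B \<longleftrightarrow>
     (\<forall>u u' v. B (u + u') v = B u v + B u' v) \<and>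
     (\<forall>u v v'. B u (v + v') = B u v + B u v') \<and>
     (\<forall>u v a b. B (act u a) (act v b) = bar a * unit_inv (bar 1) * B u v * b) \<and>
     (\<forall>u v. B u v = - bar (B v u))"

definition heis_add ::
  "('v::ab_group_add \<Rightarrow> 'v \<Rightarrow> 'r::{ring,monoid_mult}) \<Rightarrow> 'v \<times> 'r \<Rightarrow> 'v \<times> 'r \<Rightarrow> 'v \<times> 'r" where
  "heis_add B = (\<lambda>(u, a) (v, b). (u + v, a + b + B u v))"

definition heisenberg ::
  "('v::ab_group_add \<Rightarrow> 'v \<Rightarrow> 'r::{ring,monoid_mult}) \<Rightarrow> ('v \<times> 'r) monoid" where
  "heisenberg B = \<lparr>carrier = UNIV, monoid.mult = heis_add B, one = (0, 0)\<rparr>"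

definition heis_act ::
  "('r::{ring,monoid_mult} \<Rightarrow> 'r) \<Rightarrow> ('v::ab_group_add \<Rightarrow> 'r \<Rightarrow> 'v) \<Rightarrow> 'v \<times> 'r \<Rightarrow> 'r \<Rightarrow> 'v \<times> 'r" where
  "heis_act bar act = (\<lambda>(u, a) b. (act u b, bar b * unit_inv (bar 1) * a * b))"

definition odd_form_min :: "('r::{ring,monoid_mult} \<Rightarrow> 'r) \<Rightarrow> ('v::ab_group_add \<times> 'r) set" where
  "odd_form_min bar = {(0, a + bar a) | a. True}"

definition odd_form_max ::
  "('r::{ring,monoid_mult} \<Rightarrow> 'r) \<Rightarrow> ('v::ab_group_add \<Rightarrow> 'v \<Rightarrow> 'r) \<Rightarrow> ('v \<times> 'r) set" where
  "odd_form_max bar B = {(u, a). a = bar a + B u u}"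

definition odd_form_parameter ::
  "('r::{ring,monoid_mult} \<Rightarrow> 'r) \<Rightarrow> ('v::ab_group_add \<Rightarrow> 'r \<Rightarrow> 'v) \<Rightarrow> ('v \<Rightarrow> 'v \<Rightarrow> 'r)
    \<Rightarrow> ('v \<times> 'r) set \<Rightarrow> bool" where
  "odd_form_parameter bar act B L \<longleftrightarrow>
     subgroup L (heisenberg B) \<and>
     (\<forall>\<xi>\<in>L. \<forall>b. heis_act bar act \<xi> b \<in> L) \<and>
     odd_form_min bar \<subseteq> L \<and> L \<subseteq> odd_form_max bar B"

definition odd_quadratic_space ::
  "('r::{ring,monoid_mult} \<Rightarrow> 'r) \<Rightarrow> ('v::ab_group_add \<Rightarrow> 'r \<Rightarrow> 'v) \<Rightarrow> ('v \<Rightarrow> 'v \<Rightarrow> 'r)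
    \<Rightarrow> ('v \<times> 'r) set \<Rightarrow> bool" where
  "odd_quadratic_space bar act B L \<longleftrightarrow>
     right_module act \<and> anti_hermitian_form bar act B \<and> odd_form_parameter bar act B L"


section \<open>Groups given by generators and relations\<close>

text \<open>
  A word is a list of letters \<open>(True, x)\<close>, standing for the generator \<open>x\<close>, and
  \<open>(False, x)\<close>, standing for its inverse. A relation \<open>u = v\<close> is a pair of words.
  Pairs in \<open>R\<close> that involve letters outside \<open>S\<close> are disregarded.
\<close>

type_synonym 'x word = "(bool \<times> 'x) list"

definition words :: "'x set \<Rightarrow> 'x word set" where
  "words S = lists (UNIV \<times> S)"

definition word_inv :: "'x word \<Rightarrow> 'x word" where
  "word_inv w = rev (map (\<lambda>(b, x). (\<not> b, x)) w)"

definition word_comm :: "'x word \<Rightarrow> 'x word \<Rightarrow> 'x word" where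
  "word_comm u v = u @ v @ word_inv u @ word_inv v"

inductive pres_eq :: "'x set \<Rightarrow> ('x word \<times> 'x word) set \<Rightarrow> 'x word \<Rightarrow> 'x word \<Rightarrow> bool"
  for S :: "'x set" and R :: "('x word \<times> 'x word) set" where
  refl: "w \<in> words S \<Longrightarrow> pres_eq S R w w"
| sym: "pres_eq S R u v \<Longrightarrow> pres_eq S R v u"
| trans: "pres_eq S R u v \<Longrightarrow> pres_eq S R v w \<Longrightarrow> pres_eq S R u w"
| append: "pres_eq S R u v \<Longrightarrow> pres_eq S R u' v' \<Longrightarrow> pres_eq S R (u @ u') (v @ v')"
| cancel: "x \<in> S \<Longrightarrow> pres_eq S R [(b, x), (\<not> b, x)] []"
| relation: "(u, v) \<in> R \<Longrightarrow> u \<in> words S \<Longrightarrow> v \<in> words S \<Longrightarrow> pres_eq S R u v"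

definition word_class :: "'x set \<Rightarrow> ('x word \<times> 'x word) set \<Rightarrow> 'x word \<Rightarrow> 'x word set" where
  "word_class S R w = {v. pres_eq S R w v}"

definition presented_group ::
  "'x set \<Rightarrow> ('x word \<times> 'x word) set \<Rightarrow> 'x word set monoid" where
  "presented_group S R =
     \<lparr>carrier = word_class S R ` words S,
      monoid.mult = (\<lambda>A B. \<Union>u\<in>A. \<Union>v\<in>B. word_class S R (u @ v)),
      one = word_class S R []\<rparr>"

lemma words_append [simp]: "u @ v \<in> words S \<longleftrightarrow> u \<in> words S \<and> v \<in> words S"
  by (auto simp: words_def)

lemma words_Nil [simp]: "[] \<in> words S"
  by (simp add: words_def)

lemma words_Cons [simp]: "(b, x) # w \<in> words S \<longleftrightarrow> x \<in> S \<and> w \<in> words S"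
  by (auto simp: words_def)

lemma words_word_inv [simp]: "word_inv w \<in> words S \<longleftrightarrow> w \<in> words S"
  by (auto simp: words_def word_inv_def in_lists_conv_set)

lemma pres_eq_words: "pres_eq S R u v \<Longrightarrow> u \<in> words S \<and> v \<in> words S"
  by (induction rule: pres_eq.induct) auto

lemma word_class_eq_iff:
  assumes "u \<in> words S"
  shows "word_class S R u = word_class S R v \<longleftrightarrow> pres_eq S R u v"
proof
  assume "word_class S R u = word_class S R v"
  with pres_eq.refl[OF assms, of R] have "pres_eq S R v u"
    by (auto simp: word_class_def)
  then show "pres_eq S R u v"
    by (rule pres_eq.sym)
next
  assume uv: "pres_eq S R u v"
  then have "pres_eq S R u w \<longleftrightarrow> pres_eq S R v w" for w
    using pres_eq.trans[OF uv] pres_eq.trans[OF pres_eq.sym[OF uv]] by blast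
  then show "word_class S R u = word_class S R v"
    by (simp add: word_class_def)
qed

lemma presented_group_mult:
  assumes "u \<in> words S" "v \<in> words S"
  shows "word_class S R u \<otimes>\<^bsub>presented_group S R\<^esub> word_class S R v = word_class S R (u @ v)"
proof -
  have eq: "word_class S R (u' @ v') = word_class S R (u @ v)"
    if "u' \<in> word_class S R u" "v' \<in> word_class S R v" for u' v'
  proof -
    have "pres_eq S R (u @ v) (u' @ v')"
      using that by (intro pres_eq.append) (simp_all add: word_class_def)
    then show ?thesis
      using assms by (simp add: word_class_eq_iff[of "u @ v" S R "u' @ v'", symmetric])
  qed
  have "u \<in> word_class S R u" "v \<in> word_class S R v"
    using assms by (simp_all add: word_class_def pres_eq.refl)
  with eq have "(\<Union>u'\<in>word_class S R u. \<Union>v'\<in>word_class S R v. word_class S R (u' @ v'))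
      = word_class S R (u @ v)"
    by blast
  then show ?thesis
    by (simp add: presented_group_def)
qed

lemma pres_eq_inv_left: "w \<in> words S \<Longrightarrow> pres_eq S R (word_inv w @ w) []"
proof (induction w)
  case Nil
  then show ?case by (simp add: word_inv_def pres_eq.refl)
next
  case (Cons l w)
  obtain b x where l: "l = (b, x)" by (cases l)
  with Cons.prems have x: "x \<in> S" and w: "w \<in> words S" by auto
  have "pres_eq S R [(\<not> b, x), (b, x)] []"
    using pres_eq.cancel[OF x, of R "\<not> b"] by simp
  then have "pres_eq S R (word_inv w @ [(\<not> b, x), (b, x)] @ w) (word_inv w @ [] @ w)"
    using w by (intro pres_eq.append) (auto intro: pres_eq.refl)
  then have "pres_eq S R (word_inv w @ [(\<not> b, x), (b, x)] @ w) []"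
    using Cons.IH[OF w] by (auto intro: pres_eq.trans)
  then show ?case
    by (simp add: l word_inv_def)
qed

lemma group_presented_group: "group (presented_group S R)"
proof (rule groupI)
  let ?G = "presented_group S R"
  have C: "carrier ?G = word_class S R ` words S" and one: "\<one>\<^bsub>?G\<^esub> = word_class S R []"
    by (simp_all add: presented_group_def)
  show "\<one>\<^bsub>?G\<^esub> \<in> carrier ?G"
    by (auto simp: C one)
  show "x \<otimes>\<^bsub>?G\<^esub> y \<in> carrier ?G" if "x \<in> carrier ?G" "y \<in> carrier ?G" for x y
    using that by (auto simp: C presented_group_mult)
  show "x \<otimes>\<^bsub>?G\<^esub> y \<otimes>\<^bsub>?G\<^esub> z = x \<otimes>\<^bsub>?G\<^esub> (y \<otimes>\<^bsub>?G\<^esub> z)"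
    if "x \<in> carrier ?G" "y \<in> carrier ?G" "z \<in> carrier ?G" for x y z
    using that by (auto simp: C presented_group_mult)
  show "\<one>\<^bsub>?G\<^esub> \<otimes>\<^bsub>?G\<^esub> x = x" if "x \<in> carrier ?G" for x
    using that by (auto simp: C one presented_group_mult)
  show "\<exists>y\<in>carrier ?G. y \<otimes>\<^bsub>?G\<^esub> x = \<one>\<^bsub>?G\<^esub>" if x: "x \<in> carrier ?G" for x
  proof -
    obtain w where w: "w \<in> words S" "x = word_class S R w"
      using x by (auto simp: C)
    have "word_class S R (word_inv w) \<otimes>\<^bsub>?G\<^esub> x = word_class S R (word_inv w @ w)"
      using w by (simp add: presented_group_mult)
    also have "\<dots> = \<one>\<^bsub>?G\<^esub>"
      using w pres_eq_inv_left by (simp add: one word_class_eq_iff)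
    finally show ?thesis
      using w by (intro bexI[of _ "word_class S R (word_inv w)"]) (auto simp: C)
  qed
qed


section \<open>The odd unitary Steinberg group\<close>

definition index_set :: "nat \<Rightarrow> int set" where
  "index_set n = {i. i \<noteq> 0 \<and> \<bar>i\<bar> \<le> int n}"

datatype ('r, 'v) stu_gen = Gen2 int int 'r | Gen1 int "'v \<times> 'r"

abbreviation X2 :: "int \<Rightarrow> int \<Rightarrow> 'r \<Rightarrow> ('r, 'v) stu_gen word" where
  "X2 i j a \<equiv> [(True, Gen2 i j a)]"

abbreviation X1 :: "int \<Rightarrow> 'v \<times> 'r \<Rightarrow> ('r, 'v) stu_gen word" where
  "X1 i \<xi> \<equiv> [(True, Gen1 i \<xi>)]"

definition stu_gens :: "nat \<Rightarrow> ('v \<times> 'r) set \<Rightarrow> ('r, 'v) stu_gen set" where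
  "stu_gens n L =
     {Gen2 i j a | i j a. i \<in> index_set n \<and> j \<in> index_set n \<and> i \<noteq> j \<and> i \<noteq> - j} \<union>
     {Gen1 i \<xi> | i \<xi>. i \<in> index_set n \<and> \<xi> \<in> L}"

definition stu_sign :: "('r::{ring,monoid_mult} \<Rightarrow> 'r) \<Rightarrow> int \<Rightarrow> 'r" where
  "stu_sign bar i = (if i > 0 then unit_inv (bar 1) else - 1)"

text \<open>
  The side conditions saying that the symbols are defined, such as \<open>i \<noteq> \<plusminus>j\<close> in
  \<open>X2 i j a\<close> or \<open>\<xi> \<in> L\<close> in \<open>X1 i \<xi>\<close>, are not repeated in the relations:
  \<^const>\<open>presented_group\<close> only uses those pairs both of whose sides are words in
  \<^const>\<open>stu_gens\<close>.
\<close>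

inductive_set stu_rels ::
  "('r::{ring,monoid_mult} \<Rightarrow> 'r) \<Rightarrow> ('v::ab_group_add \<Rightarrow> 'r \<Rightarrow> 'v) \<Rightarrow> ('v \<Rightarrow> 'v \<Rightarrow> 'r)
    \<Rightarrow> (('r, 'v) stu_gen word \<times> ('r, 'v) stu_gen word) set"
  for bar :: "'r::{ring,monoid_mult} \<Rightarrow> 'r" and act :: "'v::ab_group_add \<Rightarrow> 'r \<Rightarrow> 'v"
    and B :: "'v \<Rightarrow> 'v \<Rightarrow> 'r" where
  R0: "(X2 i j a, X2 (- j) (- i) (stu_sign bar (- j) * bar a * stu_sign bar i)) \<in> stu_rels bar act B"
| R1: "(X2 i j a @ X2 i j b, X2 i j (a + b)) \<in> stu_rels bar act B"
| R2: "(X1 i \<xi> @ X1 i \<zeta>, X1 i (heis_add B \<xi> \<zeta>)) \<in> stu_rels bar act B"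
| R3: "h \<notin> {j, - i} \<Longrightarrow> k \<notin> {i, - j} \<Longrightarrow>
       (word_comm (X2 i j a) (X2 h k b), []) \<in> stu_rels bar act B"
| R4: "j \<noteq> - i \<Longrightarrow> k \<noteq> i \<Longrightarrow>
       (word_comm (X1 i \<xi>) (X2 j k a), []) \<in> stu_rels bar act B"
| R5: "(word_comm (X2 i j a) (X2 j k b), X2 i k (a * b)) \<in> stu_rels bar act B"
| R6: "i \<notin> {j, - j} \<Longrightarrow>
       (word_comm (X1 i (u, a)) (X1 j (v, b)), X2 i (- j) (stu_sign bar i * B u v))
         \<in> stu_rels bar act B"
| R7: "(word_comm (X1 i (u, a)) (X1 i (v, b)), X1 i (0, B u v - B v u)) \<in> stu_rels bar act B"
| R8: "(word_comm (X1 i (u, a)) (X2 (- i) j b),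
        X2 i j (stu_sign bar i * a * b) @ X1 (- j) (heis_act bar act (u, - bar a) b))
         \<in> stu_rels bar act B"
| R9: "(word_comm (X2 i j a) (X2 j (- i) b),
        X1 i (0, - stu_sign bar (- i) * bar 1 * a * b
                 + bar b * unit_inv (bar 1) * bar a * stu_sign bar i))
         \<in> stu_rels bar act B"

text \<open>\<open>StU bar act B L n\<close> is the group usually denoted $\mathrm{StU}(2n, R, L)$.\<close>

definition StU ::
  "('r::{ring,monoid_mult} \<Rightarrow> 'r) \<Rightarrow> ('v::ab_group_add \<Rightarrow> 'r \<Rightarrow> 'v) \<Rightarrow> ('v \<Rightarrow> 'v \<Rightarrow> 'r)
    \<Rightarrow> ('v \<times> 'r) set \<Rightarrow> nat \<Rightarrow> ('r, 'v) stu_gen word set monoid" where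
  "StU bar act B L n = presented_group (stu_gens n L) (stu_rels bar act B)"

text \<open>The element $X_{ij}(a)$ of $\mathrm{StU}(2n, R, L)$.\<close>

definition StU_X ::
  "('r::{ring,monoid_mult} \<Rightarrow> 'r) \<Rightarrow> ('v::ab_group_add \<Rightarrow> 'r \<Rightarrow> 'v) \<Rightarrow> ('v \<Rightarrow> 'v \<Rightarrow> 'r)
    \<Rightarrow> ('v \<times> 'r) set \<Rightarrow> nat \<Rightarrow> int \<Rightarrow> int \<Rightarrow> 'r \<Rightarrow> ('r, 'v) stu_gen word set" where
  "StU_X bar act B L n i j a = word_class (stu_gens n L) (stu_rels bar act B) (X2 i j a)"


section \<open>Central extensions\<close>

definition group_center :: "('g, 'm) monoid_scheme \<Rightarrow> 'g set" where
  "group_center G = {z \<in> carrier G. \<forall>x\<in>carrier G. z \<otimes>\<^bsub>G\<^esub> x = x \<otimes>\<^bsub>G\<^esub> z}"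

definition group_comm :: "('g, 'm) monoid_scheme \<Rightarrow> 'g \<Rightarrow> 'g \<Rightarrow> 'g" where
  "group_comm G x y = x \<otimes>\<^bsub>G\<^esub> y \<otimes>\<^bsub>G\<^esub> inv\<^bsub>G\<^esub> x \<otimes>\<^bsub>G\<^esub> inv\<^bsub>G\<^esub> y"

definition central_extension :: "'h monoid \<Rightarrow> 'g monoid \<Rightarrow> ('h \<Rightarrow> 'g) \<Rightarrow> bool" where
  "central_extension H G \<epsilon> \<longleftrightarrow>
     group H \<and> group G \<and> \<epsilon> \<in> epi H G \<and> kernel H G \<epsilon> \<subseteq> group_center H"

text \<open>
  A formula cannot quantify over all types, so the carriers of the groups \<open>H\<close> in the universal
  property have to live on one fixed type. The type \<open>'u word set\<close> below is large enough
  for this to be no restriction: by lemma \<open>universal_central_extension_any_type\<close> the universal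
  property then holds with respect to the central extensions \<open>H\<close> on an arbitrary type.
  Homomorphisms only matter on the carrier, whence \<^const>\<open>extensional\<close>.
\<close>

definition universal_central_extension :: "'u monoid \<Rightarrow> 'g monoid \<Rightarrow> ('u \<Rightarrow> 'g) \<Rightarrow> bool" where
  "universal_central_extension U G \<pi> \<longleftrightarrow>
     central_extension U G \<pi> \<and>
     (\<forall>(H :: 'u word set monoid) \<epsilon>. central_extension H G \<epsilon> \<longrightarrow>
        (\<exists>!\<eta>. \<eta> \<in> hom U H \<inter> extensional (carrier U) \<and> (\<forall>x\<in>carrier U. \<epsilon> (\<eta> x) = \<pi> x)))"

lemma small_copy:
  fixes K :: "'k monoid" and p :: "'y \<Rightarrow> 'k"
  assumes K: "group K" and p: "carrier K \<subseteq> range p"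
  shows "\<exists>(K' :: 'y set monoid) \<phi>. group K' \<and> \<phi> \<in> iso K' K"
proof -
  interpret K: group K by (rule K)
  define q where "q k = p -` {k}" for k
  have inj: "inj_on q (carrier K)"
    unfolding q_def inj_on_def using p by blast
  define r where "r = inv_into (carrier K) q"
  have r: "r (q x) = x" if "x \<in> carrier K" for x
    using inj that by (simp add: r_def)
  define K' where "K' = \<lparr>carrier = q ` carrier K,
    monoid.mult = (\<lambda>A B. q (r A \<otimes>\<^bsub>K\<^esub> r B)), one = q \<one>\<^bsub>K\<^esub>\<rparr>"
  have "group K'"
  proof (rule groupI)
    show "\<exists>y\<in>carrier K'. y \<otimes>\<^bsub>K'\<^esub> x = \<one>\<^bsub>K'\<^esub>" if "x \<in> carrier K'" for x
    proof -
      have "x \<in> q ` carrier K"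
        using that by (simp add: K'_def)
      then obtain k where k: "k \<in> carrier K" "x = q k"
        by blast
      have "q (inv\<^bsub>K\<^esub> k) \<in> carrier K'"
        using k(1) by (simp add: K'_def)
      moreover have "q (inv\<^bsub>K\<^esub> k) \<otimes>\<^bsub>K'\<^esub> x = \<one>\<^bsub>K'\<^esub>"
        using k(1) by (simp add: k(2) K'_def r)
      ultimately show ?thesis ..
    qed
  qed (auto simp: K'_def r K.m_assoc)
  moreover have "r \<in> iso K' K"
    unfolding iso_def hom_def bij_betw_def
    by (auto simp: K'_def r inj_on_def image_iff)
  ultimately show ?thesis by blast
qed

lemma central_extension_small_copy:
  fixes K :: "'k monoid" and p :: "'y \<Rightarrow> 'k"
  assumes ext: "central_extension K G \<epsilon>" and p: "carrier K \<subseteq> range p"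
  obtains K' :: "'y set monoid" and \<phi>
    where "\<phi> \<in> iso K' K" "central_extension K' G (\<epsilon> \<circ> \<phi>)"
proof -
  from ext have K: "group K" and G: "group G" and \<epsilon>: "\<epsilon> \<in> epi K G"
    and ker: "kernel K G \<epsilon> \<subseteq> group_center K"
    by (auto simp: central_extension_def)
  obtain K' :: "'y set monoid" and \<phi> where K': "group K'" and \<phi>: "\<phi> \<in> iso K' K"
    using small_copy[OF K p] by blast
  have hom: "\<phi> \<in> hom K' K" and bij: "bij_betw \<phi> (carrier K') (carrier K)"
    using \<phi> by (auto simp: iso_def)
  have mult: "\<phi> (x \<otimes>\<^bsub>K'\<^esub> y) = \<phi> x \<otimes>\<^bsub>K\<^esub> \<phi> y" if "x \<in> carrier K'" "y \<in> carrier K'" for x y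
    using hom that by (simp add: hom_mult)
  have closed: "\<phi> x \<in> carrier K" if "x \<in> carrier K'" for x
    using hom that by (simp add: hom_in_carrier)
  have "(\<epsilon> \<circ> \<phi>) ` carrier K' = \<epsilon> ` carrier K"
    by (simp only: image_comp[symmetric] bij_betw_imp_surj_on[OF bij])
  moreover have "\<epsilon> \<circ> \<phi> \<in> hom K' G"
    using \<epsilon> by (intro hom_compose[OF hom]) (simp add: epi_def)
  ultimately have "\<epsilon> \<circ> \<phi> \<in> epi K' G"
    using \<epsilon> by (simp add: epi_def)
  moreover have "z \<in> group_center K'" if z: "z \<in> kernel K' G (\<epsilon> \<circ> \<phi>)" for z
  proof -
    have z': "z \<in> carrier K'" using z by (simp add: kernel_def)
    have "\<phi> z \<in> kernel K G \<epsilon>"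
      using z closed by (auto simp: kernel_def)
    with ker have c: "\<phi> z \<otimes>\<^bsub>K\<^esub> k = k \<otimes>\<^bsub>K\<^esub> \<phi> z" if "k \<in> carrier K" for k
      using that by (auto simp: group_center_def)
    have "z \<otimes>\<^bsub>K'\<^esub> x = x \<otimes>\<^bsub>K'\<^esub> z" if x: "x \<in> carrier K'" for x
    proof (rule inj_onD[OF bij_betw_imp_inj_on[OF bij]])
      show "\<phi> (z \<otimes>\<^bsub>K'\<^esub> x) = \<phi> (x \<otimes>\<^bsub>K'\<^esub> z)"
        using c[OF closed[OF x]] x z' by (simp add: mult)
      show "z \<otimes>\<^bsub>K'\<^esub> x \<in> carrier K'" "x \<otimes>\<^bsub>K'\<^esub> z \<in> carrier K'"
        using K' x z' by (simp_all add: group.subgroup_self monoid.m_closed group.is_monoid)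
    qed
    with z' show ?thesis by (simp add: group_center_def)
  qed
  ultimately have "central_extension K' G (\<epsilon> \<circ> \<phi>)"
    using K' G by (auto simp: central_extension_def)
  with \<phi> that show thesis by blast
qed

lemma universal_lift_exists:
  fixes U :: "'u monoid" and H :: "'h monoid"
  assumes univ: "universal_central_extension U G \<pi>" and ext: "central_extension H G \<epsilon>"
  shows "\<exists>\<eta>\<in>hom U H. \<forall>x\<in>carrier U. \<epsilon> (\<eta> x) = \<pi> x"
proof -
  from ext have H: "group H" and G: "group G" and \<epsilon>: "\<epsilon> \<in> epi H G"
    and ker: "kernel H G \<epsilon> \<subseteq> group_center H"
    by (auto simp: central_extension_def)
  have U: "group U" and \<pi>: "\<pi> \<in> epi U G"
    using univ by (auto simp: universal_central_extension_def central_extension_def)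
  interpret H: group H by (rule H)
  have \<epsilon>hom: "\<epsilon> \<in> hom H G" and \<epsilon>im: "\<epsilon> ` carrier H = carrier G"
    and \<pi>im: "\<pi> ` carrier U = carrier G"
    using \<epsilon> \<pi> by (auto simp: epi_def)
  define s where "s u = (if u \<in> carrier U then SOME h. h \<in> carrier H \<and> \<epsilon> h = \<pi> u else \<one>\<^bsub>H\<^esub>)" for u
  have s: "s u \<in> carrier H \<and> \<epsilon> (s u) = \<pi> u" if "u \<in> carrier U" for u
  proof -
    have "\<exists>h. h \<in> carrier H \<and> \<epsilon> h = \<pi> u"
      using that \<epsilon>im \<pi>im by (metis imageE imageI)
    from someI_ex[OF this] that show ?thesis by (simp add: s_def)
  qed
  have sc: "s u \<in> carrier H" for u
    using s[of u] by (cases "u \<in> carrier U") (auto simp: s_def)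
  define f where "f l = (if fst l then s (snd l) else inv\<^bsub>H\<^esub> s (snd l))" for l :: "bool \<times> 'u"
  have fc: "f l \<in> carrier H" for l
    using sc by (simp add: f_def)
  define p where "p w = foldr (\<lambda>l h. f l \<otimes>\<^bsub>H\<^esub> h) w \<one>\<^bsub>H\<^esub>" for w
  have p_Nil: "p [] = \<one>\<^bsub>H\<^esub>" and p_Cons: "p (l # w) = f l \<otimes>\<^bsub>H\<^esub> p w" for l w
    by (simp_all add: p_def)
  have pc: "p w \<in> carrier H" for w
    by (induction w) (auto simp: p_Nil p_Cons fc)
  have p_append: "p (v @ w) = p v \<otimes>\<^bsub>H\<^esub> p w" for v w
    by (induction v) (auto simp: p_Nil p_Cons fc pc H.m_assoc)
  have p_single: "p [l] = f l" for l
    by (simp add: p_Nil p_Cons fc)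
  have p_inv: "\<exists>v. inv\<^bsub>H\<^esub> p w = p v" for w
  proof (induction w)
    case Nil
    show ?case by (metis p_Nil H.inv_one)
  next
    case (Cons l w)
    then obtain v where v: "inv\<^bsub>H\<^esub> p w = p v" by blast
    have "inv\<^bsub>H\<^esub> f l = p [(\<not> fst l, snd l)]"
      using sc by (auto simp: p_single f_def)
    then have "inv\<^bsub>H\<^esub> p (l # w) = p (v @ [(\<not> fst l, snd l)])"
      by (simp add: p_append p_Cons H.inv_mult_group fc pc v)
    then show ?case by blast
  qed
  have sub: "subgroup (range p) H"
  proof (rule H.subgroupI)
    show "range p \<subseteq> carrier H" using pc by blast
    show "inv\<^bsub>H\<^esub> a \<in> range p" if "a \<in> range p" for a
      using that p_inv by auto
    show "a \<otimes>\<^bsub>H\<^esub> b \<in> range p" if "a \<in> range p" "b \<in> range p" for a b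
      using that by (auto simp flip: p_append)
  qed simp
  define K where "K = H\<lparr>carrier := range p\<rparr>"
  have K_simps: "carrier K = range p" "monoid.mult K = monoid.mult H" "one K = one H"
    by (simp_all add: K_def)
  have K: "group K"
    unfolding K_def by (rule H.subgroup_imp_group[OF sub])
  have "\<epsilon> ` range p = carrier G"
  proof
    show "\<epsilon> ` range p \<subseteq> carrier G" using pc \<epsilon>im by blast
    show "carrier G \<subseteq> \<epsilon> ` range p"
    proof
      fix g assume "g \<in> carrier G"
      then obtain u where u: "u \<in> carrier U" "g = \<pi> u" using \<pi>im by blast
      then have "g = \<epsilon> (p [(True, u)])" using s by (simp add: p_single f_def)
      then show "g \<in> \<epsilon> ` range p" by blast
    qed
  qed
  then have "\<epsilon> \<in> epi K G"
    using \<epsilon>hom pc by (auto simp: epi_def hom_def K_simps Pi_iff)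
  moreover have "kernel K G \<epsilon> \<subseteq> group_center K"
  proof
    fix z assume "z \<in> kernel K G \<epsilon>"
    then have z: "z \<in> range p" "\<epsilon> z = \<one>\<^bsub>G\<^esub>"
      by (simp_all add: kernel_def K_simps)
    then have "z \<in> kernel H G \<epsilon>"
      using pc by (auto simp: kernel_def)
    then have "z \<in> group_center H"
      using ker by blast
    with z(1) pc show "z \<in> group_center K"
      unfolding group_center_def K_simps by blast
  qed
  ultimately have "central_extension K G \<epsilon>"
    using K G by (simp add: central_extension_def)
  moreover have "carrier K \<subseteq> range p" by (simp add: K_simps)
  ultimately obtain K' :: "'u word set monoid" and \<phi>
    where \<phi>: "\<phi> \<in> iso K' K" and K': "central_extension K' G (\<epsilon> \<circ> \<phi>)"
    using central_extension_small_copy[of K G \<epsilon> p] by blast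
  obtain \<eta> where \<eta>: "\<eta> \<in> hom U K'" "\<forall>x\<in>carrier U. (\<epsilon> \<circ> \<phi>) (\<eta> x) = \<pi> x"
    using univ K' unfolding universal_central_extension_def by blast
  have "\<phi> \<circ> \<eta> \<in> hom U K"
    using \<eta>(1) \<phi> by (auto simp: iso_def intro: hom_compose)
  then have "\<phi> \<circ> \<eta> \<in> hom U H"
    using pc by (auto simp: hom_def K_simps Pi_iff)
  with \<eta>(2) show ?thesis by (intro bexI[of _ "\<phi> \<circ> \<eta>"]) auto
qed

lemma universal_lift_unique:
  fixes U :: "'u monoid" and H :: "'h monoid"
  assumes univ: "universal_central_extension U G \<pi>" and ext: "central_extension H G \<epsilon>"
    and \<eta>: "\<eta> \<in> hom U H" "\<And>x. x \<in> carrier U \<Longrightarrow> \<epsilon> (\<eta> x) = \<pi> x"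
    and \<theta>: "\<theta> \<in> hom U H" "\<And>x. x \<in> carrier U \<Longrightarrow> \<epsilon> (\<theta> x) = \<pi> x"
    and u: "u \<in> carrier U"
  shows "\<eta> u = \<theta> u"
proof -
  from ext have H: "group H" and G: "group G" and \<epsilon>: "\<epsilon> \<in> hom H G"
    and ker: "kernel H G \<epsilon> \<subseteq> group_center H"
    by (auto simp: central_extension_def epi_def)
  have U: "group U" and \<pi>hom: "\<pi> \<in> hom U G" and \<pi>im: "\<pi> ` carrier U = carrier G"
    using univ by (auto simp: universal_central_extension_def central_extension_def epi_def)
  interpret H: group H by (rule H)
  interpret G: group G by (rule G)
  interpret U: group U by (rule U)
  interpret \<epsilon>: group_hom H G \<epsilon> by unfold_locales (rule \<epsilon>)
  interpret \<pi>: group_hom U G \<pi> by unfold_locales (rule \<pi>hom)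
  interpret \<eta>: group_hom U H \<eta> by unfold_locales (rule \<eta>(1))
  interpret \<theta>: group_hom U H \<theta> by unfold_locales (rule \<theta>(1))
  define \<delta> where "\<delta> x = \<eta> x \<otimes>\<^bsub>H\<^esub> inv\<^bsub>H\<^esub> \<theta> x" for x
  have \<delta>c: "\<delta> x \<in> carrier H" if "x \<in> carrier U" for x
    using that by (simp add: \<delta>_def)
  have central: "\<delta> x \<otimes>\<^bsub>H\<^esub> h = h \<otimes>\<^bsub>H\<^esub> \<delta> x" if x: "x \<in> carrier U" and h: "h \<in> carrier H" for x h
  proof -
    have "\<epsilon> (\<delta> x) = \<one>\<^bsub>G\<^esub>"
      using x by (simp add: \<delta>_def \<eta>(2) \<theta>(2))
    then have "\<delta> x \<in> group_center H"
      using ker \<delta>c[OF x] by (auto simp: kernel_def)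
    then show ?thesis using h by (simp add: group_center_def)
  qed
  have \<delta>mult: "\<delta> (x \<otimes>\<^bsub>U\<^esub> y) = \<delta> x \<otimes>\<^bsub>H\<^esub> \<delta> y" if x: "x \<in> carrier U" and y: "y \<in> carrier U" for x y
  proof -
    have "\<delta> (x \<otimes>\<^bsub>U\<^esub> y) = \<eta> x \<otimes>\<^bsub>H\<^esub> (\<delta> y \<otimes>\<^bsub>H\<^esub> inv\<^bsub>H\<^esub> \<theta> x)"
      using x y by (simp add: \<delta>_def H.inv_mult_group H.m_assoc)
    also have "\<dots> = \<eta> x \<otimes>\<^bsub>H\<^esub> (inv\<^bsub>H\<^esub> \<theta> x \<otimes>\<^bsub>H\<^esub> \<delta> y)"
      using central[OF y, of "inv\<^bsub>H\<^esub> \<theta> x"] x by simp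
    also have "\<dots> = \<delta> x \<otimes>\<^bsub>H\<^esub> \<delta> y"
      using x y \<delta>c by (simp add: \<delta>_def[of x] H.m_assoc)
    finally show ?thesis .
  qed
  have \<delta>hom: "\<delta> \<in> hom U H"
    using \<delta>c \<delta>mult by (simp add: hom_def)
  interpret \<delta>: group_hom U H \<delta> by unfold_locales (rule \<delta>hom)
  define Z where "Z = H\<lparr>carrier := \<delta> ` carrier U\<rparr>"
  have Z_simps: "carrier Z = \<delta> ` carrier U" "monoid.mult Z = monoid.mult H" "one Z = one H"
    by (simp_all add: Z_def)
  have Z: "group Z"
    unfolding Z_def using \<delta>.img_is_subgroup by (rule H.subgroup_imp_group)
  define K where "K = G \<times>\<times> Z"
  have K: "group K"
    unfolding K_def by (rule DirProd_group[OF G Z])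
  have Kc: "carrier K = carrier G \<times> \<delta> ` carrier U"
    by (simp add: K_def Z_simps)
  have "fst \<in> hom K G"
    by (auto simp: hom_def K_def)
  moreover have "fst ` carrier K = carrier G"
    using U.one_closed by (auto simp: Kc fst_image_times)
  ultimately have "fst \<in> epi K G"
    by (simp add: epi_def)
  moreover have "kernel K G fst \<subseteq> group_center K"
  proof
    fix k assume "k \<in> kernel K G fst"
    then obtain x where x: "x \<in> carrier U" "k = (\<one>\<^bsub>G\<^esub>, \<delta> x)"
      by (auto simp: kernel_def Kc)
    have "k \<otimes>\<^bsub>K\<^esub> l = l \<otimes>\<^bsub>K\<^esub> k" if l: "l \<in> carrier K" for l
    proof -
      obtain g y where y: "g \<in> carrier G" "y \<in> carrier U" "l = (g, \<delta> y)"
        using l by (auto simp: Kc)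
      have "\<delta> x \<otimes>\<^bsub>H\<^esub> \<delta> y = \<delta> y \<otimes>\<^bsub>H\<^esub> \<delta> x"
        using x(1) y(2) by (intro central \<delta>c)
      with y(1) show ?thesis
        by (simp add: x(2) y(3) K_def Z_simps)
    qed
    with x show "k \<in> group_center K"
      by (auto simp: group_center_def Kc)
  qed
  ultimately have extK: "central_extension K G fst"
    using K G by (simp add: central_extension_def)
  define p where "p w = (\<pi> (snd (w ! 0)), \<delta> (snd (w ! 1)))" for w :: "'u word"
  have p: "carrier K \<subseteq> range p"
  proof
    fix k assume "k \<in> carrier K"
    then obtain x y where "k = (\<pi> x, \<delta> y)" unfolding Kc \<pi>im[symmetric] by blast
    then have "k = p [(True, x), (True, y)]" by (simp add: p_def)
    then show "k \<in> range p" by blast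
  qed
  obtain K' :: "'u word set monoid" and \<phi>
    where \<phi>: "\<phi> \<in> iso K' K" and K': "central_extension K' G (fst \<circ> \<phi>)"
    using central_extension_small_copy[OF extK p] by blast
  have K'g: "group K'" using K' by (simp add: central_extension_def)
  define \<psi> where "\<psi> = inv_into (carrier K') \<phi>"
  have \<psi>: "\<psi> \<in> iso K K'"
    unfolding \<psi>_def using group.iso_set_sym[OF K'g \<phi>] .
  then have \<psi>hom: "\<psi> \<in> hom K K'" by (simp add: iso_def)
  have \<phi>\<psi>: "\<phi> (\<psi> k) = k" if "k \<in> carrier K" for k
    using that \<phi> unfolding \<psi>_def
    by (intro f_inv_into_f) (auto simp: iso_def bij_betw_def)
  let ?P = "\<lambda>\<eta>. \<eta> \<in> hom U K' \<inter> extensional (carrier U) \<and>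
    (\<forall>x\<in>carrier U. (fst \<circ> \<phi>) (\<eta> x) = \<pi> x)"
  have ex1: "\<exists>!\<eta>. ?P \<eta>"
    using univ K' unfolding universal_central_extension_def by blast
  have lift: "?P (restrict (\<lambda>x. \<psi> (\<pi> x, d x)) (carrier U))"
    if d: "\<And>x. x \<in> carrier U \<Longrightarrow> d x \<in> \<delta> ` carrier U"
      and dm: "\<And>x y. x \<in> carrier U \<Longrightarrow> y \<in> carrier U \<Longrightarrow> d (x \<otimes>\<^bsub>U\<^esub> y) = d x \<otimes>\<^bsub>H\<^esub> d y" for d
  proof -
    have in_K: "(\<pi> x, d x) \<in> carrier K" if "x \<in> carrier U" for x
      using d that by (auto simp: Kc)
    have mult_K: "(\<pi> (x \<otimes>\<^bsub>U\<^esub> y), d (x \<otimes>\<^bsub>U\<^esub> y)) = (\<pi> x, d x) \<otimes>\<^bsub>K\<^esub> (\<pi> y, d y)"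
      if "x \<in> carrier U" "y \<in> carrier U" for x y
      using that dm by (simp add: K_def Z_simps)
    have "restrict (\<lambda>x. \<psi> (\<pi> x, d x)) (carrier U) \<in> hom U K'"
    proof (rule homI)
      show "restrict (\<lambda>x. \<psi> (\<pi> x, d x)) (carrier U) x \<in> carrier K'" if "x \<in> carrier U" for x
        using that in_K hom_in_carrier[OF \<psi>hom] by simp
      show "restrict (\<lambda>x. \<psi> (\<pi> x, d x)) (carrier U) (x \<otimes>\<^bsub>U\<^esub> y) =
          restrict (\<lambda>x. \<psi> (\<pi> x, d x)) (carrier U) x \<otimes>\<^bsub>K'\<^esub>
          restrict (\<lambda>x. \<psi> (\<pi> x, d x)) (carrier U) y"
        if "x \<in> carrier U" "y \<in> carrier U" for x y
        using that by (simp only: restrict_apply' U.m_closed mult_K hom_mult[OF \<psi>hom in_K in_K])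
    qed
    then show ?thesis by (simp add: \<phi>\<psi> in_K)
  qed
  have "\<one>\<^bsub>H\<^esub> \<in> \<delta> ` carrier U"
    using \<delta>.hom_one U.one_closed by (metis imageI)
  then have "?P (restrict (\<lambda>x. \<psi> (\<pi> x, \<one>\<^bsub>H\<^esub>)) (carrier U))"
    by (intro lift) auto
  moreover have "?P (restrict (\<lambda>x. \<psi> (\<pi> x, \<delta> x)) (carrier U))"
    by (intro lift) (auto simp: \<delta>mult)
  ultimately have "restrict (\<lambda>x. \<psi> (\<pi> x, \<delta> x)) (carrier U) = restrict (\<lambda>x. \<psi> (\<pi> x, \<one>\<^bsub>H\<^esub>)) (carrier U)"
    using ex1 by blast
  from fun_cong[OF this, of u] have "\<psi> (\<pi> u, \<delta> u) = \<psi> (\<pi> u, \<one>\<^bsub>H\<^esub>)"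
    using u by simp
  moreover have "(\<pi> u, \<delta> u) \<in> carrier K" "(\<pi> u, \<one>\<^bsub>H\<^esub>) \<in> carrier K"
    using u \<open>\<one>\<^bsub>H\<^esub> \<in> \<delta> ` carrier U\<close> by (auto simp: Kc)
  ultimately have "\<delta> u = \<one>\<^bsub>H\<^esub>"
    by (metis \<phi>\<psi> prod.inject)
  then show ?thesis
    using u by (metis H.inv_closed H.inv_equality H.inv_inv \<delta>_def \<eta>.hom_closed \<theta>.hom_closed)
qed

lemma universal_central_extension_any_type:
  fixes U :: "'u monoid" and H :: "'h monoid"
  assumes "universal_central_extension U G \<pi>" and "central_extension H G \<epsilon>"
  shows "\<exists>!\<eta>. \<eta> \<in> hom U H \<inter> extensional (carrier U) \<and> (\<forall>x\<in>carrier U. \<epsilon> (\<eta> x) = \<pi> x)"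
proof -
  have U: "group U"
    using assms(1) by (simp add: universal_central_extension_def central_extension_def)
  obtain \<eta> where \<eta>: "\<eta> \<in> hom U H" "\<forall>x\<in>carrier U. \<epsilon> (\<eta> x) = \<pi> x"
    using universal_lift_exists[OF assms] by blast
  have "restrict \<eta> (carrier U) \<in> hom U H"
    using \<eta>(1) U by (auto simp: hom_def group.is_monoid monoid.m_closed)
  then show ?thesis
    using \<eta>(2) by (intro ex1I[of _ "restrict \<eta> (carrier U)"])
      (auto intro!: extensionalityI[of _ "carrier U"] universal_lift_unique[OF assms])
qed

end

theory Submission
  imports Defs
begin

text \<open>
  Let \<open>N\<close> be the subgroup of \<open>U\<close> generated by the commutators in question. Long root elements
  whose four indices are distinct up to sign commute in the Steinberg group \<open>G\<close>, so \<open>N\<close> lies in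
  the kernel of \<open>\<pi>\<close>. That kernel is central, so \<open>N\<close> is normal and \<open>U Mod N\<close> is a central
  extension of \<open>G\<close> (lemma \<open>central_extension_quotient\<close>). It suffices that this extension has a
  section \<open>\<phi>\<close>: then \<open>\<phi> \<circ> \<pi>\<close> and the quotient map \<open>U \<rightarrow> U Mod N\<close> are both lifts of \<open>\<pi>\<close>, they
  agree because \<open>\<pi>\<close> is universal, and so everything that \<open>\<pi>\<close> kills lies in \<open>N\<close>.

  As \<open>G\<close> is given by generators and relations, a section amounts to a choice of lifts of the root
  elements for which the Steinberg relations still hold (\<open>StU_hom_of_steinberg_family\<close>). These are
  found in an arbitrary central extension \<open>H\<close> in which lifts of the long root elements with four
  distinct indices commute (\<open>steinberg_family_lift\<close>). The commutator of two elements of \<open>H\<close>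
  depends only on their images in \<open>G\<close>; write \<open>\<langle>g, g'\<rangle>\<close> for it (\<open>comm_lift g g'\<close> below). Nearly
  all relations are about commutators, so the lifts are themselves defined by commutators:
  \<open>Y\<^sub>i\<^sub>j(a) = \<langle>X\<^sub>i\<^sub>k(1), X\<^sub>k\<^sub>j(a)\<rangle>\<close> for long roots, and for short roots the element that solves the
  relation for \<open>[X\<^sub>k(\<xi>), X\<^sub>-\<^sub>k\<^sub>,\<^sub>-\<^sub>j(1)]\<close>. The work lies in showing that nothing depends on the
  auxiliary index \<open>k\<close>.

  Two facts drive this. If \<open>x\<close> commutes with \<open>y\<close> and with \<open>z\<close> in \<open>G\<close>, then \<open>\<langle>x, [y, z]\<rangle> = 1\<close>
  (\<open>comm_lift_group_comm_trivial\<close>). A root element factors as \<open>X\<^sub>h\<^sub>k(b) = [X\<^sub>h\<^sub>l(1), X\<^sub>l\<^sub>k(b)]\<close>, so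
  commuting root elements have commuting lifts as soon as there is an index \<open>l\<close> away from the
  indices involved. With four index classes such an \<open>l\<close> is missing only if the indices of two long
  roots exhaust all classes, and this is the obstruction that \<open>N\<close> kills. Secondly, if the lifts of
  \<open>x\<close> and \<open>z\<close> commute, then a form of the Hall-Witt identity expresses \<open>\<langle>x, [y, z]\<rangle>\<close> by
  \<open>\<langle>[x, y], z\<rangle>\<close> (\<open>comm_lift_witt\<close>), which moves the auxiliary index. For short roots it compares
  the candidates for \<open>k\<close> and for \<open>-l\<close> up to the lift \<open>T\<^sub>j(s)\<close> of \<open>X\<^sub>j(0, s + bar s)\<close> coming from long
  roots; since the candidate is additive in \<open>\<xi>\<close> and has the value \<open>T\<^sub>j(s)\<close> at \<open>(0, s + bar s)\<close>
  (\<open>Z_min_eq_T\<close>), the difference disappears (\<open>comm_lift_S_E_opp_shift\<close>).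
\<close>

section \<open>Commutators and central extensions\<close>

context group
begin

lemma inv_mult_cancel [simp]:
  "x \<in> carrier G \<Longrightarrow> y \<in> carrier G \<Longrightarrow> inv x \<otimes> (x \<otimes> y) = y"
  "x \<in> carrier G \<Longrightarrow> y \<in> carrier G \<Longrightarrow> x \<otimes> (inv x \<otimes> y) = y"
  by (simp_all flip: m_assoc)

lemma group_comm_closed [simp]:
  "x \<in> carrier G \<Longrightarrow> y \<in> carrier G \<Longrightarrow> group_comm G x y \<in> carrier G"
  by (simp add: group_comm_def)

lemma group_comm_mult: "x \<in> carrier G \<Longrightarrow> y \<in> carrier G \<Longrightarrow> group_comm G x y \<otimes> (y \<otimes> x) = x \<otimes> y"
  by (simp add: group_comm_def m_assoc)

lemma group_comm_eq_one_iff: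
  assumes "x \<in> carrier G" "y \<in> carrier G"
  shows "group_comm G x y = \<one> \<longleftrightarrow> x \<otimes> y = y \<otimes> x"
proof
  assume "group_comm G x y = \<one>"
  then show "x \<otimes> y = y \<otimes> x"
    using group_comm_mult[OF assms] assms by simp
next
  assume "x \<otimes> y = y \<otimes> x"
  then have "group_comm G x y = y \<otimes> x \<otimes> inv x \<otimes> inv y"
    by (simp add: group_comm_def)
  then show "group_comm G x y = \<one>"
    using assms by (simp add: m_assoc)
qed

lemma inv_group_comm:
  "x \<in> carrier G \<Longrightarrow> y \<in> carrier G \<Longrightarrow> inv (group_comm G x y) = group_comm G y x"
  by (simp add: group_comm_def inv_mult_group m_assoc)

lemma conj_eq_group_comm_mult:
  "x \<in> carrier G \<Longrightarrow> y \<in> carrier G \<Longrightarrow> x \<otimes> y \<otimes> inv x = group_comm G x y \<otimes> y"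
  by (simp add: group_comm_def m_assoc)

lemma group_comm_mult_left:
  "x \<in> carrier G \<Longrightarrow> y \<in> carrier G \<Longrightarrow> z \<in> carrier G \<Longrightarrow>
    group_comm G (x \<otimes> y) z = x \<otimes> group_comm G y z \<otimes> inv x \<otimes> group_comm G x z"
  by (simp add: group_comm_def m_assoc inv_mult_group)

lemma group_comm_mult_right:
  "x \<in> carrier G \<Longrightarrow> y \<in> carrier G \<Longrightarrow> z \<in> carrier G \<Longrightarrow>
    group_comm G x (y \<otimes> z) = group_comm G x y \<otimes> (y \<otimes> group_comm G x z \<otimes> inv y)"
  by (simp add: group_comm_def m_assoc inv_mult_group)

lemma group_comm_conj:
  "x \<in> carrier G \<Longrightarrow> y \<in> carrier G \<Longrightarrow> z \<in> carrier G \<Longrightarrow>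
    group_comm G (x \<otimes> y \<otimes> inv x) (x \<otimes> z \<otimes> inv x) = x \<otimes> group_comm G y z \<otimes> inv x"
  by (simp add: group_comm_def m_assoc inv_mult_group)

lemma commute_conj:
  assumes "x \<otimes> y = y \<otimes> x" "x \<in> carrier G" "y \<in> carrier G"
  shows "x \<otimes> y \<otimes> inv x = y"
  unfolding assms(1) using assms(2,3) by (simp add: m_assoc)

lemma commute_mult:
  assumes "x \<otimes> y = y \<otimes> x" "x \<otimes> z = z \<otimes> x" "x \<in> carrier G" "y \<in> carrier G" "z \<in> carrier G"
  shows "x \<otimes> (y \<otimes> z) = y \<otimes> z \<otimes> x"
proof -
  have "x \<otimes> (y \<otimes> z) = (x \<otimes> y) \<otimes> z"
    using assms(3-5) by (simp add: m_assoc)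
  also have "\<dots> = y \<otimes> (x \<otimes> z)"
    unfolding assms(1) using assms(3-5) by (simp add: m_assoc)
  also have "\<dots> = y \<otimes> z \<otimes> x"
    unfolding assms(2) using assms(3-5) by (simp add: m_assoc)
  finally show ?thesis .
qed

lemma commute_inv:
  assumes "x \<otimes> y = y \<otimes> x" "x \<in> carrier G" "y \<in> carrier G"
  shows "x \<otimes> inv y = inv y \<otimes> x"
proof -
  have "x \<otimes> inv y = inv y \<otimes> (y \<otimes> x) \<otimes> inv y"
    using assms(2,3) by (simp add: m_assoc)
  also have "\<dots> = inv y \<otimes> x"
    unfolding assms(1)[symmetric] using assms(2,3) by (simp add: m_assoc)
  finally show ?thesis .
qed

lemma commute_group_comm:
  assumes "x \<otimes> y = y \<otimes> x" "x \<otimes> z = z \<otimes> x" "x \<in> carrier G" "y \<in> carrier G" "z \<in> carrier G"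
  shows "x \<otimes> group_comm G y z = group_comm G y z \<otimes> x"
proof -
  note closed = assms(3-5)
  have "x \<otimes> (y \<otimes> z) = y \<otimes> z \<otimes> x"
    by (rule commute_mult[OF assms])
  then have "x \<otimes> (y \<otimes> z \<otimes> inv y) = y \<otimes> z \<otimes> inv y \<otimes> x"
    by (rule commute_mult[OF _ commute_inv[OF assms(1)]]) (use closed in auto)
  then show ?thesis
    unfolding group_comm_def
    by (rule commute_mult[OF _ commute_inv[OF assms(2)]]) (use closed in auto)
qed

text \<open>
  Conjugation by \<open>x\<close> fixes \<open>z\<close> and replaces \<open>y\<close> by \<open>[x, y] y\<close>, so it replaces \<open>[y, z]\<close> by
  \<open>[[x, y] y, z]\<close>, which is then expanded.
\<close>

lemma group_comm_witt:
  assumes c: "x \<otimes> z = z \<otimes> x" and [simp]: "x \<in> carrier G" "y \<in> carrier G" "z \<in> carrier G"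
  shows "group_comm G x (group_comm G y z) =
    group_comm G (group_comm G x y) (group_comm G y z) \<otimes>
    group_comm G (group_comm G y z) (group_comm G (group_comm G x y) z) \<otimes>
    group_comm G (group_comm G x y) z"
proof -
  have "x \<otimes> group_comm G y z \<otimes> inv x = group_comm G (x \<otimes> y \<otimes> inv x) (x \<otimes> z \<otimes> inv x)"
    by (simp add: group_comm_conj)
  also have "\<dots> = group_comm G (group_comm G x y \<otimes> y) z"
    by (simp only: commute_conj[OF c assms(2,4)] conj_eq_group_comm_mult[OF assms(2,3)])
  finally have "group_comm G x (group_comm G y z) =
    (group_comm G x y \<otimes> group_comm G y z \<otimes> inv (group_comm G x y)) \<otimes>
    group_comm G (group_comm G x y) z \<otimes> inv (group_comm G y z)"
    by (simp add: group_comm_mult_left m_assoc group_comm_def[of G x "group_comm G y z"])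
  also have "\<dots> = group_comm G (group_comm G x y) (group_comm G y z) \<otimes>
    (group_comm G y z \<otimes> group_comm G (group_comm G x y) z \<otimes> inv (group_comm G y z))"
    by (simp only: conj_eq_group_comm_mult[of "group_comm G x y" "group_comm G y z"]
        group_comm_closed assms) (simp add: m_assoc)
  finally show ?thesis
    by (simp only: conj_eq_group_comm_mult[of "group_comm G y z" "group_comm G (group_comm G x y) z"]
        group_comm_closed assms) (simp add: m_assoc)
qed

text \<open>
  Conjugation by \<open>z\<close> replaces \<open>[x, y]\<close> by \<open>[x' x, y' y]\<close>. Under the commutation hypotheses the
  latter splits into the commutators of the factors, which are \<open>[x, y]\<close> and the three on the right.
\<close>

lemma group_comm_nested:
  assumes [simp]: "x \<in> carrier G" "y \<in> carrier G" "z \<in> carrier G"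
  defines "x' \<equiv> group_comm G z x" and "y' \<equiv> group_comm G z y"
  assumes c: "x' \<otimes> group_comm G x y = group_comm G x y \<otimes> x'"
    "y' \<otimes> group_comm G x y = group_comm G x y \<otimes> y'"
    "x' \<otimes> group_comm G x y' = group_comm G x y' \<otimes> x'"
    "y' \<otimes> group_comm G x' y = group_comm G x' y \<otimes> y'"
    "group_comm G x y \<otimes> group_comm G x' y = group_comm G x' y \<otimes> group_comm G x y"
  shows "group_comm G z (group_comm G x y) =
    group_comm G x y' \<otimes> group_comm G x' y' \<otimes> group_comm G x' y"
proof -
  have [simp]: "x' \<in> carrier G" "y' \<in> carrier G"
    by (simp_all add: x'_def y'_def)
  let ?c = "group_comm G x y"
  have "z \<otimes> ?c \<otimes> inv z = group_comm G (x' \<otimes> x) (y' \<otimes> y)"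
    by (simp only: group_comm_conj[symmetric] conj_eq_group_comm_mult x'_def y'_def assms(1-3))
  also have "\<dots> = x' \<otimes> group_comm G x (y' \<otimes> y) \<otimes> inv x' \<otimes> group_comm G x' (y' \<otimes> y)"
    by (simp add: group_comm_mult_left)
  also have "group_comm G x (y' \<otimes> y) = group_comm G x y' \<otimes> ?c"
    by (simp add: group_comm_mult_right commute_conj[OF c(2)])
  also have "group_comm G x' (y' \<otimes> y) = group_comm G x' y' \<otimes> group_comm G x' y"
    by (simp add: group_comm_mult_right commute_conj[OF c(4)])
  also have "x' \<otimes> (group_comm G x y' \<otimes> ?c) \<otimes> inv x' = group_comm G x y' \<otimes> ?c"
    by (intro commute_conj commute_mult[OF c(3,1)]) auto
  finally have *: "z \<otimes> ?c \<otimes> inv z =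
    group_comm G x y' \<otimes> (?c \<otimes> (group_comm G x' y' \<otimes> group_comm G x' y))" by (simp add: m_assoc)
  have "?c \<otimes> (group_comm G x' y' \<otimes> group_comm G x' y) =
     group_comm G x' y' \<otimes> group_comm G x' y \<otimes> ?c"
    by (intro commute_mult[OF commute_group_comm[OF c(1,2)[symmetric]] c(5)]) auto
  with * have "z \<otimes> ?c \<otimes> inv z =
      group_comm G x y' \<otimes> group_comm G x' y' \<otimes> group_comm G x' y \<otimes> ?c"
    by (simp add: m_assoc)
  moreover have "group_comm G z ?c = z \<otimes> ?c \<otimes> inv z \<otimes> inv ?c"
    by (simp add: group_comm_def[of G z])
  ultimately show ?thesis
    by (simp add: m_assoc)
qed

end

locale central_ext =
  fixes H :: "'h monoid" and G :: "'g monoid" and \<epsilon> :: "'h \<Rightarrow> 'g"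
  assumes central_extension: "central_extension H G \<epsilon>"
begin

sublocale H: group H
  using central_extension by (simp add: central_extension_def)

sublocale G: group G
  using central_extension by (simp add: central_extension_def)

lemma ext_hom: "\<epsilon> \<in> hom H G"
  using central_extension by (simp add: central_extension_def epi_def)

lemma ext_simps [simp]:
  shows ext_closed: "x \<in> carrier H \<Longrightarrow> \<epsilon> x \<in> carrier G"
    and ext_mult: "x \<in> carrier H \<Longrightarrow> y \<in> carrier H \<Longrightarrow> \<epsilon> (x \<otimes>\<^bsub>H\<^esub> y) = \<epsilon> x \<otimes>\<^bsub>G\<^esub> \<epsilon> y"
    and ext_one: "\<epsilon> \<one>\<^bsub>H\<^esub> = \<one>\<^bsub>G\<^esub>"
    and ext_inv: "x \<in> carrier H \<Longrightarrow> \<epsilon> (inv\<^bsub>H\<^esub> x) = inv\<^bsub>G\<^esub> \<epsilon> x"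
proof -
  interpret group_hom H G \<epsilon>
    by unfold_locales (rule ext_hom)
  show "x \<in> carrier H \<Longrightarrow> \<epsilon> x \<in> carrier G"
    "x \<in> carrier H \<Longrightarrow> y \<in> carrier H \<Longrightarrow> \<epsilon> (x \<otimes>\<^bsub>H\<^esub> y) = \<epsilon> x \<otimes>\<^bsub>G\<^esub> \<epsilon> y"
    "\<epsilon> \<one>\<^bsub>H\<^esub> = \<one>\<^bsub>G\<^esub>" "x \<in> carrier H \<Longrightarrow> \<epsilon> (inv\<^bsub>H\<^esub> x) = inv\<^bsub>G\<^esub> \<epsilon> x"
    by simp_all
qed

lemma obtain_preimage:
  assumes "g \<in> carrier G"
  obtains h where "h \<in> carrier H" "\<epsilon> h = g"
proof -
  have "g \<in> \<epsilon> ` carrier H"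
    using central_extension assms by (simp add: central_extension_def epi_def)
  then show thesis
    using that by blast
qed

lemma kernel_commutes:
  "z \<in> carrier H \<Longrightarrow> \<epsilon> z = \<one>\<^bsub>G\<^esub> \<Longrightarrow> h \<in> carrier H \<Longrightarrow> z \<otimes>\<^bsub>H\<^esub> h = h \<otimes>\<^bsub>H\<^esub> z"
proof -
  assume *: "z \<in> carrier H" "\<epsilon> z = \<one>\<^bsub>G\<^esub>" "h \<in> carrier H"
  then have "z \<in> kernel H G \<epsilon>"
    by (simp add: kernel_def)
  then have "z \<in> group_center H"
    using central_extension unfolding central_extension_def by blast
  then show "z \<otimes>\<^bsub>H\<^esub> h = h \<otimes>\<^bsub>H\<^esub> z"
    using *(3) by (simp add: group_center_def)
qed

text \<open>
  The preimages chosen here are immaterial by lemma \<open>group_comm_eq_comm_lift\<close>, through which the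
  definition is always used. Indexing commutators in \<open>H\<close> by elements of \<open>G\<close> lets every relation of
  \<open>G\<close> be applied inside them.
\<close>

definition comm_lift :: "'g \<Rightarrow> 'g \<Rightarrow> 'h" where
  "comm_lift g g' = group_comm H (inv_into (carrier H) \<epsilon> g) (inv_into (carrier H) \<epsilon> g')"

lemma group_comm_cong:
  assumes xy[simp]: "x \<in> carrier H" "x' \<in> carrier H" "y \<in> carrier H" and eq: "\<epsilon> x' = \<epsilon> x"
  shows "group_comm H x' y = group_comm H x y"
proof -
  define z where "z = inv\<^bsub>H\<^esub> x \<otimes>\<^bsub>H\<^esub> x'"
  have [simp]: "z \<in> carrier H" and "\<epsilon> z = \<one>\<^bsub>G\<^esub>"
    by (simp_all add: z_def eq)
  then have "group_comm H z y = \<one>\<^bsub>H\<^esub>"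
    using kernel_commutes[of z y] by (simp add: H.group_comm_eq_one_iff)
  moreover have "x' = x \<otimes>\<^bsub>H\<^esub> z"
    by (simp add: z_def)
  ultimately show ?thesis
    by (simp add: H.group_comm_mult_left)
qed

lemma group_comm_eq_comm_lift:
  assumes xy[simp]: "x \<in> carrier H" "y \<in> carrier H"
  shows "group_comm H x y = comm_lift (\<epsilon> x) (\<epsilon> y)"
proof -
  let ?i = "inv_into (carrier H) \<epsilon>"
  have [simp]: "?i (\<epsilon> h) \<in> carrier H" "\<epsilon> (?i (\<epsilon> h)) = \<epsilon> h" if "h \<in> carrier H" for h
    using inv_into_into[of "\<epsilon> h" \<epsilon> "carrier H"] f_inv_into_f[of "\<epsilon> h" \<epsilon> "carrier H"] that by auto
  have "group_comm H x y = group_comm H (?i (\<epsilon> x)) y"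
    by (rule group_comm_cong) auto
  also have "\<dots> = inv\<^bsub>H\<^esub> group_comm H y (?i (\<epsilon> x))"
    by (simp add: H.inv_group_comm)
  also have "group_comm H y (?i (\<epsilon> x)) = group_comm H (?i (\<epsilon> y)) (?i (\<epsilon> x))"
    by (rule group_comm_cong) auto
  also have "inv\<^bsub>H\<^esub> \<dots> = comm_lift (\<epsilon> x) (\<epsilon> y)"
    by (simp add: H.inv_group_comm comm_lift_def)
  finally show ?thesis .
qed

lemma ext_group_comm [simp]:
  "x \<in> carrier H \<Longrightarrow> y \<in> carrier H \<Longrightarrow> \<epsilon> (group_comm H x y) = group_comm G (\<epsilon> x) (\<epsilon> y)"
  by (simp add: group_comm_def)

lemma comm_lift_closed [simp]:
  assumes "g \<in> carrier G" "h \<in> carrier G"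
  shows "comm_lift g h \<in> carrier H"
proof -
  obtain x y where "x \<in> carrier H" "\<epsilon> x = g" "y \<in> carrier H" "\<epsilon> y = h"
    using assms obtain_preimage by metis
  then show ?thesis
    using group_comm_eq_comm_lift[of x y] H.group_comm_closed[of x y] by simp
qed

lemma ext_comm_lift [simp]:
  assumes "g \<in> carrier G" "h \<in> carrier G"
  shows "\<epsilon> (comm_lift g h) = group_comm G g h"
proof -
  obtain x y where "x \<in> carrier H" "\<epsilon> x = g" "y \<in> carrier H" "\<epsilon> y = h"
    using assms obtain_preimage by metis
  then show ?thesis
    using group_comm_eq_comm_lift[of x y] ext_group_comm[of x y] by simp
qed

lemma inv_comm_lift:
  assumes "g \<in> carrier G" "h \<in> carrier G"
  shows "inv\<^bsub>H\<^esub> comm_lift g h = comm_lift h g"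
proof -
  obtain x y where "x \<in> carrier H" "\<epsilon> x = g" "y \<in> carrier H" "\<epsilon> y = h"
    using assms obtain_preimage by metis
  then show ?thesis
    using group_comm_eq_comm_lift[of x y] group_comm_eq_comm_lift[of y x] H.inv_group_comm[of x y]
    by simp
qed

lemma comm_lift_sym_one:
  assumes "comm_lift g h = \<one>\<^bsub>H\<^esub>" "g \<in> carrier G" "h \<in> carrier G"
  shows "comm_lift h g = \<one>\<^bsub>H\<^esub>"
  using inv_comm_lift[OF assms(2,3)] assms(1) by simp

lemma commute_iff_comm_lift:
  "x \<in> carrier H \<Longrightarrow> y \<in> carrier H \<Longrightarrow>
    x \<otimes>\<^bsub>H\<^esub> y = y \<otimes>\<^bsub>H\<^esub> x \<longleftrightarrow> comm_lift (\<epsilon> x) (\<epsilon> y) = \<one>\<^bsub>H\<^esub>"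
  by (simp add: H.group_comm_eq_one_iff flip: group_comm_eq_comm_lift)

lemma comm_lift_mult_right:
  assumes "g \<in> carrier G" "h \<in> carrier G" "h' \<in> carrier G"
  shows "comm_lift g (h \<otimes>\<^bsub>G\<^esub> h') =
    comm_lift g h \<otimes>\<^bsub>H\<^esub> (comm_lift h (group_comm G g h') \<otimes>\<^bsub>H\<^esub> comm_lift g h')"
proof -
  obtain x y z where *: "x \<in> carrier H" "\<epsilon> x = g" "y \<in> carrier H" "\<epsilon> y = h" "z \<in> carrier H" "\<epsilon> z = h'"
    using assms obtain_preimage by metis
  then have "group_comm H x (y \<otimes>\<^bsub>H\<^esub> z) =
      group_comm H x y \<otimes>\<^bsub>H\<^esub> (group_comm H y (group_comm H x z) \<otimes>\<^bsub>H\<^esub> group_comm H x z)"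
    by (simp add: H.group_comm_mult_right H.conj_eq_group_comm_mult)
  then show ?thesis
    using * assms by (simp add: group_comm_eq_comm_lift)
qed

lemma comm_lift_mult_left:
  assumes "g \<in> carrier G" "g' \<in> carrier G" "h \<in> carrier G"
  shows "comm_lift (g \<otimes>\<^bsub>G\<^esub> g') h =
    comm_lift g (group_comm G g' h) \<otimes>\<^bsub>H\<^esub> comm_lift g' h \<otimes>\<^bsub>H\<^esub> comm_lift g h"
proof -
  obtain x y z where *: "x \<in> carrier H" "\<epsilon> x = g" "y \<in> carrier H" "\<epsilon> y = g'" "z \<in> carrier H" "\<epsilon> z = h"
    using assms obtain_preimage by metis
  then have "group_comm H (x \<otimes>\<^bsub>H\<^esub> y) z =
      group_comm H x (group_comm H y z) \<otimes>\<^bsub>H\<^esub> group_comm H y z \<otimes>\<^bsub>H\<^esub> group_comm H x z"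
    by (simp add: H.group_comm_mult_left H.conj_eq_group_comm_mult)
  then show ?thesis
    using * assms by (simp add: group_comm_eq_comm_lift)
qed

lemma comm_lift_one [simp]:
  assumes "g \<in> carrier G"
  shows "comm_lift g \<one>\<^bsub>G\<^esub> = \<one>\<^bsub>H\<^esub>" "comm_lift \<one>\<^bsub>G\<^esub> g = \<one>\<^bsub>H\<^esub>"
proof -
  obtain x where "x \<in> carrier H" "\<epsilon> x = g"
    using assms obtain_preimage by metis
  then show "comm_lift g \<one>\<^bsub>G\<^esub> = \<one>\<^bsub>H\<^esub>" "comm_lift \<one>\<^bsub>G\<^esub> g = \<one>\<^bsub>H\<^esub>"
    using commute_iff_comm_lift[of x "\<one>\<^bsub>H\<^esub>"] commute_iff_comm_lift[of "\<one>\<^bsub>H\<^esub>" x] by simp_all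
qed

lemma comm_lift_mult_right_trivial:
  assumes "comm_lift g h' = \<one>\<^bsub>H\<^esub>" "g \<in> carrier G" "h \<in> carrier G" "h' \<in> carrier G"
  shows "comm_lift g (h \<otimes>\<^bsub>G\<^esub> h') = comm_lift g h"
  using comm_lift_mult_right[OF assms(2-4)] ext_comm_lift[OF assms(2,4), symmetric] assms by simp

lemma comm_lift_mult_left_trivial:
  assumes "comm_lift g' h = \<one>\<^bsub>H\<^esub>" "g \<in> carrier G" "g' \<in> carrier G" "h \<in> carrier G"
  shows "comm_lift (g \<otimes>\<^bsub>G\<^esub> g') h = comm_lift g h"
  using comm_lift_mult_left[OF assms(2-4)] ext_comm_lift[OF assms(3,4), symmetric] assms by simp

text \<open>
  Conjugation by a lift of \<open>x\<close> changes lifts of \<open>y\<close> and \<open>z\<close> only by central factors, and these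
  do not affect the commutator.
\<close>

lemma comm_lift_group_comm_trivial:
  assumes "group_comm G x y = \<one>\<^bsub>G\<^esub>" "group_comm G x z = \<one>\<^bsub>G\<^esub>"
    and "x \<in> carrier G" "y \<in> carrier G" "z \<in> carrier G"
  shows "comm_lift x (group_comm G y z) = \<one>\<^bsub>H\<^esub>"
proof -
  obtain a b c where *: "a \<in> carrier H" "\<epsilon> a = x" "b \<in> carrier H" "\<epsilon> b = y" "c \<in> carrier H" "\<epsilon> c = z"
    using assms(3-5) obtain_preimage by metis
  have "a \<otimes>\<^bsub>H\<^esub> group_comm H b c \<otimes>\<^bsub>H\<^esub> inv\<^bsub>H\<^esub> a
      = group_comm H (group_comm H a b \<otimes>\<^bsub>H\<^esub> b) (group_comm H a c \<otimes>\<^bsub>H\<^esub> c)"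
    using * by (simp only: H.group_comm_conj[symmetric] H.conj_eq_group_comm_mult)
  also have "\<dots> = comm_lift (\<epsilon> b) (\<epsilon> c)"
    using * assms by (simp add: group_comm_eq_comm_lift)
  also have "\<dots> = group_comm H b c"
    using * by (simp add: group_comm_eq_comm_lift)
  finally have "group_comm H a (group_comm H b c) = \<one>\<^bsub>H\<^esub>"
    using * by (simp add: group_comm_def[of H a "group_comm H b c"])
  with * show ?thesis
    using group_comm_eq_comm_lift[of a "group_comm H b c"] by simp
qed

lemma comm_lift_witt:
  assumes "comm_lift x z = \<one>\<^bsub>H\<^esub>" and closed [simp]: "x \<in> carrier G" "y \<in> carrier G" "z \<in> carrier G"
  shows "comm_lift x (group_comm G y z) =
    comm_lift (group_comm G x y) (group_comm G y z) \<otimes>\<^bsub>H\<^esub>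
    comm_lift (group_comm G y z) (group_comm G (group_comm G x y) z) \<otimes>\<^bsub>H\<^esub>
    comm_lift (group_comm G x y) z"
proof -
  obtain a b c where *: "a \<in> carrier H" "\<epsilon> a = x" "b \<in> carrier H" "\<epsilon> b = y" "c \<in> carrier H" "\<epsilon> c = z"
    using closed obtain_preimage by metis
  then have "a \<otimes>\<^bsub>H\<^esub> c = c \<otimes>\<^bsub>H\<^esub> a"
    using assms(1) by (simp add: commute_iff_comm_lift)
  from H.group_comm_witt[OF this, of b] * have "group_comm H a (group_comm H b c) =
      group_comm H (group_comm H a b) (group_comm H b c) \<otimes>\<^bsub>H\<^esub>
      group_comm H (group_comm H b c) (group_comm H (group_comm H a b) c) \<otimes>\<^bsub>H\<^esub>
      group_comm H (group_comm H a b) c"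
    by simp
  with * show ?thesis
    by (simp add: group_comm_eq_comm_lift)
qed

lemma comm_lift_witt_simple:
  assumes "comm_lift x z = \<one>\<^bsub>H\<^esub>"
    and "comm_lift (group_comm G x y) (group_comm G y z) = \<one>\<^bsub>H\<^esub>"
    and "comm_lift (group_comm G y z) (group_comm G (group_comm G x y) z) = \<one>\<^bsub>H\<^esub>"
    and "x \<in> carrier G" "y \<in> carrier G" "z \<in> carrier G"
  shows "comm_lift x (group_comm G y z) = comm_lift (group_comm G x y) z"
  using assms by (simp add: comm_lift_witt[OF assms(1)])

lemma comm_lift_nested:
  assumes [simp]: "x \<in> carrier G" "y \<in> carrier G" "z \<in> carrier G"
  defines "x' \<equiv> group_comm G z x" and "y' \<equiv> group_comm G z y"
  assumes c: "comm_lift x' (group_comm G x y) = \<one>\<^bsub>H\<^esub>"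
    "comm_lift y' (group_comm G x y) = \<one>\<^bsub>H\<^esub>"
    "comm_lift x' (group_comm G x y') = \<one>\<^bsub>H\<^esub>"
    "comm_lift y' (group_comm G x' y) = \<one>\<^bsub>H\<^esub>"
    "comm_lift (group_comm G x y) (group_comm G x' y) = \<one>\<^bsub>H\<^esub>"
  shows "comm_lift z (group_comm G x y) =
    comm_lift x y' \<otimes>\<^bsub>H\<^esub> comm_lift x' y' \<otimes>\<^bsub>H\<^esub> comm_lift x' y"
proof -
  obtain a b d where *: "a \<in> carrier H" "\<epsilon> a = x" "b \<in> carrier H" "\<epsilon> b = y" "d \<in> carrier H" "\<epsilon> d = z"
    using assms(1-3) obtain_preimage by metis
  from c have "group_comm H d (group_comm H a b) =
    group_comm H a (group_comm H d b) \<otimes>\<^bsub>H\<^esub> group_comm H (group_comm H d a) (group_comm H d b)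
      \<otimes>\<^bsub>H\<^esub> group_comm H (group_comm H d a) b"
    using * unfolding x'_def y'_def
    by (intro H.group_comm_nested) (simp_all add: commute_iff_comm_lift)
  with * show ?thesis
    by (simp add: group_comm_eq_comm_lift x'_def y'_def)
qed

end

section \<open>Odd quadratic spaces\<close>

text \<open>
  Below, \<open>e\<close> stands for the image of 1 under the pseudo-involution; it is invertible but need not
  be central. The lemmas on \<open>sgn_ix\<close> (the \<open>\<epsilon>\<^sub>i\<close> of the Steinberg relations) carry an extra right
  factor \<open>x\<close> in their second versions because products are normalised to the right.
\<close>

locale quadratic_space =
  fixes bar :: "'r::{ring,monoid_mult} \<Rightarrow> 'r"
    and act :: "'v::ab_group_add \<Rightarrow> 'r \<Rightarrow> 'v"
    and B :: "'v \<Rightarrow> 'v \<Rightarrow> 'r"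
    and L :: "('v \<times> 'r) set"
  assumes pseudo_involution: "pseudo_involution bar"
    and odd_quadratic_space: "odd_quadratic_space bar act B L"
begin

abbreviation e :: 'r where "e \<equiv> bar 1"
abbreviation e_inv :: 'r where "e_inv \<equiv> unit_inv e"
abbreviation sgn_ix :: "int \<Rightarrow> 'r" where "sgn_ix \<equiv> stu_sign bar"

lemma e_inv: "e * e_inv = 1 \<and> e_inv * e = 1"
proof -
  obtain y where y: "e * y = 1" "y * e = 1"
    using pseudo_involution by (auto simp: pseudo_involution_def)
  have "e_inv = y"
    unfolding unit_inv_def
  proof (rule the_equality)
    show "z = y" if "e * z = 1 \<and> z * e = 1" for z
      using that y by (metis mult.assoc mult_1_left mult_1_right)
  qed (use y in blast)
  with y show ?thesis by simp
qed

lemma e_cancel [simp]: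
  "e * e_inv = 1" "e_inv * e = 1" "e * (e_inv * x) = x" "e_inv * (e * x) = x"
  using e_inv by (simp_all flip: mult.assoc)

lemma bar_add [simp]: "bar (a + b) = bar a + bar b"
  and bar_bar [simp]: "bar (bar a) = a"
  and bar_mult: "bar (a * b) = bar b * (e_inv * bar a)"
  using pseudo_involution by (simp_all add: pseudo_involution_def mult.assoc)

lemma bar_zero [simp]: "bar 0 = 0"
  using bar_add[of 0 0] by simp

lemma bar_minus [simp]: "bar (- a) = - bar a"
  using minus_unique[of "bar a" "bar (- a)"] bar_add[of a "- a"] by simp

lemma bar_diff [simp]: "bar (a - b) = bar a - bar b"
  using bar_add[of a "- b"] by simp

lemma bar_e_inv [simp]: "bar e_inv = e * e"
proof -
  have "bar (e * e_inv) = e"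
    by simp
  then have "bar e_inv * e_inv = e"
    unfolding bar_mult by simp
  then have "bar e_inv * e_inv * e = e * e"
    by simp
  then show ?thesis
    by (simp add: mult.assoc)
qed

lemma bar_sgn_mult:
  "bar (sgn_ix i) * sgn_ix i = e" "bar (sgn_ix i) * (sgn_ix i * x) = e * x"
  "bar (sgn_ix i) * (e_inv * sgn_ix i) = 1" "bar (sgn_ix i) * (e_inv * (sgn_ix i * x)) = x"
  by (simp_all add: stu_sign_def mult.assoc)

lemma sgn_minus_mult:
  assumes "i \<noteq> 0"
  shows "sgn_ix i * sgn_ix (- i) = - e_inv" "sgn_ix i * (sgn_ix (- i) * x) = - (e_inv * x)"
    "sgn_ix (- i) * sgn_ix i = - e_inv" "sgn_ix (- i) * (sgn_ix i * x) = - (e_inv * x)"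
  using assms by (auto simp: stu_sign_def)

lemma sgn_minus_e_mult:
  assumes "i \<noteq> 0"
  shows "sgn_ix (- i) * (e * sgn_ix i) = - 1" "sgn_ix (- i) * (e * (sgn_ix i * x)) = - x"
    "sgn_ix i * (sgn_ix (- i) * e) = - 1" "sgn_ix i * (sgn_ix (- i) * (e * x)) = - x"
  using assms by (auto simp: stu_sign_def mult.assoc)

lemma act_add: "act (u + v) a = act u a + act v a"
  and act_one [simp]: "act u 1 = u"
  using odd_quadratic_space by (simp_all add: odd_quadratic_space_def right_module_def)

lemma act_zero_left [simp]: "act 0 b = 0"
  using act_add[of 0 0 b] by simp

lemma form: "anti_hermitian_form bar act B"
  using odd_quadratic_space by (simp add: odd_quadratic_space_def)

lemma B_add [simp]: "B (u + v) w = B u w + B v w" "B u (v + w) = B u v + B u w"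
  using form unfolding anti_hermitian_form_def by blast+

lemma B_antisym: "B u v = - bar (B v u)"
  using form unfolding anti_hermitian_form_def by blast

lemma bar_B: "bar (B u v) = - B v u"
  using B_antisym[of v u] by simp

lemma B_zero [simp]: "B 0 v = 0" "B u 0 = 0"
  using B_add(1)[of 0 0 v] B_add(2)[of u 0 0] by simp_all

lemma L_parameter: "odd_form_parameter bar act B L"
  using odd_quadratic_space by (simp add: odd_quadratic_space_def)

lemma L_subgroup: "subgroup L (heisenberg B)"
  using L_parameter by (simp add: odd_form_parameter_def)

lemma L_zero [simp]: "(0, 0) \<in> L"
  using subgroup.one_closed[OF L_subgroup] by (simp add: heisenberg_def)

lemma L_heis_add [simp]: "\<xi> \<in> L \<Longrightarrow> \<zeta> \<in> L \<Longrightarrow> heis_add B \<xi> \<zeta> \<in> L"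
  using subgroup.m_closed[OF L_subgroup, of \<xi> \<zeta>] by (simp add: heisenberg_def)

lemma L_act [simp]: "\<xi> \<in> L \<Longrightarrow> heis_act bar act \<xi> b \<in> L"
  using L_parameter by (simp add: odd_form_parameter_def)

lemma L_min [simp]: "(0, s + bar s) \<in> L"
proof -
  have "(0, s + bar s) \<in> odd_form_min bar"
    unfolding odd_form_min_def by blast
  then show ?thesis
    using L_parameter unfolding odd_form_parameter_def by blast
qed

text \<open>
  The parameter transformation that the relation for \<open>[X\<^sub>k(\<xi>), X\<^sub>-\<^sub>k\<^sub>,\<^sub>-\<^sub>j(1)]\<close> imposes: its short
  factor is \<open>X\<^sub>j(twist \<xi>)\<close>.
\<close>

definition twist :: "'v \<times> 'r \<Rightarrow> 'v \<times> 'r" where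
  "twist \<xi> = (fst \<xi>, - bar (snd \<xi>))"

lemma twist_twist [simp]: "twist (twist \<xi>) = \<xi>"
  and twist_Pair [simp]: "twist (u, a) = (u, - bar a)"
  by (simp_all add: twist_def)

lemma twist_closed [simp]: "twist \<xi> \<in> L" if "\<xi> \<in> L"
proof -
  obtain u a where \<xi>: "\<xi> = (u, a)" by (cases \<xi>)
  have "(u, a) \<in> L" using that \<xi> by simp
  have "(0, - (a + bar a)) \<in> L"
    using L_min[of "- a"] by simp
  from L_heis_add[OF this \<open>(u, a) \<in> L\<close>] show ?thesis
    by (simp add: \<xi> heis_add_def)
qed

lemma twist_L_closed [simp]: "(u, a) \<in> L \<Longrightarrow> (u, - bar a) \<in> L"
  using twist_closed[of "(u, a)"] by simp

lemma heis_act_one [simp]: "heis_act bar act \<xi> 1 = \<xi>"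
  by (cases \<xi>) (simp add: heis_act_def)

lemma L_R7: "(0, B u v - B v u) \<in> L"
  using L_min[of "B u v"] by (simp add: bar_B)

text \<open>
  This puts the parameter of a commutator of long root elements into the visibly admissible form
  \<open>(0, s + bar s)\<close>.
\<close>

lemma R9_parameter:
  assumes "i \<noteq> 0"
  shows "- sgn_ix (- i) * e * a * b + bar b * e_inv * bar a * sgn_ix i =
    - (sgn_ix (- i) * (e * (a * b))) + bar (- (sgn_ix (- i) * (e * (a * b))))"
proof -
  have "bar (sgn_ix (- i) * (e * c)) = - (bar c * sgn_ix i)" for c
    using assms by (cases "i > 0") (simp_all add: stu_sign_def bar_mult mult.assoc)
  then show ?thesis
    by (simp add: mult.assoc bar_mult[of a b])
qed

end

section \<open>Families of elements that satisfy the Steinberg relations\<close>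

definition root_pair :: "nat \<Rightarrow> int \<Rightarrow> int \<Rightarrow> bool" where
  "root_pair n i j \<longleftrightarrow> i \<in> index_set n \<and> j \<in> index_set n \<and> \<bar>i\<bar> \<noteq> \<bar>j\<bar>"

lemma index_set_minus [simp]: "- i \<in> index_set n \<longleftrightarrow> i \<in> index_set n"
  by (auto simp: index_set_def)

lemma root_pair_minus [simp]:
  "root_pair n (- i) j \<longleftrightarrow> root_pair n i j" "root_pair n i (- j) \<longleftrightarrow> root_pair n i j"
  by (auto simp: root_pair_def)

lemma root_pair_sym: "root_pair n i j \<Longrightarrow> root_pair n j i"
  by (auto simp: root_pair_def)

lemma root_pairD:
  assumes "root_pair n i j"
  shows "root_pair n j i" "i \<in> index_set n" "j \<in> index_set n" "i \<noteq> 0" "j \<noteq> 0"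
    "i \<noteq> j" "j \<noteq> i" "i \<noteq> - j" "j \<noteq> - i" "- i \<noteq> j" "- j \<noteq> i"
  using assms by (auto simp: root_pair_def index_set_def)

text \<open>
  This is the only place where the rank enters: three index classes never exhaust the available
  ones.
\<close>

lemma obtain_index:
  assumes "4 \<le> n"
  obtains l where "l \<in> index_set n" "\<bar>l\<bar> \<noteq> \<bar>i\<bar>" "\<bar>l\<bar> \<noteq> \<bar>j\<bar>" "\<bar>l\<bar> \<noteq> \<bar>k\<bar>"
proof -
  have "card {\<bar>i\<bar>, \<bar>j\<bar>, \<bar>k\<bar>} < card {1..4::int}"
    by (simp add: card_insert_if)
  then have "\<not> {1..4::int} \<subseteq> {\<bar>i\<bar>, \<bar>j\<bar>, \<bar>k\<bar>}"
    using card_mono[of "{\<bar>i\<bar>, \<bar>j\<bar>, \<bar>k\<bar>}" "{1..4::int}"] by auto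
  then obtain l where "l \<in> {1..4}" "l \<notin> {\<bar>i\<bar>, \<bar>j\<bar>, \<bar>k\<bar>}" by blast
  with assms show thesis
    by (intro that[of l]) (auto simp: index_set_def)
qed

text \<open>
  The elements \<open>E i j a\<close> and \<open>S i \<xi>\<close> of an arbitrary group play the roles of \<open>X\<^sub>i\<^sub>j(a)\<close> and
  \<open>X\<^sub>i(\<xi>)\<close>. The locale serves twice: as the hypothesis on the group that is being extended and as the
  property to be established for the lifts.
\<close>

locale steinberg_family = quadratic_space bar act B L + group G
  for bar :: "'r::{ring,monoid_mult} \<Rightarrow> 'r" and act :: "'v::ab_group_add \<Rightarrow> 'r \<Rightarrow> 'v"
    and B :: "'v \<Rightarrow> 'v \<Rightarrow> 'r" and L :: "('v \<times> 'r) set" and G :: "'g monoid" (structure) +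
  fixes n :: nat and E :: "int \<Rightarrow> int \<Rightarrow> 'r \<Rightarrow> 'g" and S :: "int \<Rightarrow> 'v \<times> 'r \<Rightarrow> 'g"
  assumes E_closed [simp]: "root_pair n i j \<Longrightarrow> E i j a \<in> carrier G"
    and S_closed [simp]: "i \<in> index_set n \<Longrightarrow> \<xi> \<in> L \<Longrightarrow> S i \<xi> \<in> carrier G"
    and E_minus: "root_pair n i j \<Longrightarrow>
      E i j a = E (- j) (- i) (stu_sign bar (- j) * bar a * stu_sign bar i)"
    and E_add: "root_pair n i j \<Longrightarrow> E i j a \<otimes>\<^bsub>G\<^esub> E i j b = E i j (a + b)"
    and S_add: "i \<in> index_set n \<Longrightarrow> \<xi> \<in> L \<Longrightarrow> \<zeta> \<in> L \<Longrightarrow>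
      S i \<xi> \<otimes>\<^bsub>G\<^esub> S i \<zeta> = S i (heis_add B \<xi> \<zeta>)"
    and comm_E_E: "root_pair n i j \<Longrightarrow> root_pair n h k \<Longrightarrow> h \<notin> {j, - i} \<Longrightarrow> k \<notin> {i, - j} \<Longrightarrow>
      group_comm G (E i j a) (E h k b) = \<one>\<^bsub>G\<^esub>"
    and comm_S_E: "i \<in> index_set n \<Longrightarrow> \<xi> \<in> L \<Longrightarrow> root_pair n j k \<Longrightarrow> j \<noteq> - i \<Longrightarrow> k \<noteq> i \<Longrightarrow>
      group_comm G (S i \<xi>) (E j k a) = \<one>\<^bsub>G\<^esub>"
    and comm_E_E_mult: "root_pair n i j \<Longrightarrow> root_pair n j k \<Longrightarrow> root_pair n i k \<Longrightarrow>
      group_comm G (E i j a) (E j k b) = E i k (a * b)"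
    and comm_S_S: "root_pair n i j \<Longrightarrow> (u, a) \<in> L \<Longrightarrow> (v, b) \<in> L \<Longrightarrow>
      group_comm G (S i (u, a)) (S j (v, b)) = E i (- j) (stu_sign bar i * B u v)"
    and comm_S_S_same: "i \<in> index_set n \<Longrightarrow> (u, a) \<in> L \<Longrightarrow> (v, b) \<in> L \<Longrightarrow>
      group_comm G (S i (u, a)) (S i (v, b)) = S i (0, B u v - B v u)"
    and comm_S_E_opp: "root_pair n i j \<Longrightarrow> (u, a) \<in> L \<Longrightarrow>
      group_comm G (S i (u, a)) (E (- i) j b) =
        E i j (stu_sign bar i * a * b) \<otimes>\<^bsub>G\<^esub> S (- j) (heis_act bar act (u, - bar a) b)"
    and comm_E_E_short: "root_pair n i j \<Longrightarrow>
      group_comm G (E i j a) (E j (- i) b) =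
        S i (0, - stu_sign bar (- i) * bar 1 * a * b
                + bar b * unit_inv (bar 1) * bar a * stu_sign bar i)"
begin

lemma E_zero: "root_pair n i j \<Longrightarrow> E i j 0 = \<one>\<^bsub>G\<^esub>"
  using E_add[of i j 0 0] by (simp add: l_cancel_one)

lemma inv_E: "root_pair n i j \<Longrightarrow> inv\<^bsub>G\<^esub> E i j a = E i j (- a)"
  using E_add[of i j "- a" a] by (intro inv_equality) (simp_all add: E_zero)

end

section \<open>Lifting the Steinberg relations to a central extension\<close>

text \<open>
  The last assumption is the only commutation relation between root elements that has to be
  imposed on the extension.
\<close>

locale steinberg_lift = steinberg_family bar act B L G n E S + central_ext H G \<epsilon>
  for bar :: "'r::{ring,monoid_mult} \<Rightarrow> 'r" and act :: "'v::ab_group_add \<Rightarrow> 'r \<Rightarrow> 'v"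
    and B :: "'v \<Rightarrow> 'v \<Rightarrow> 'r" and L :: "('v \<times> 'r) set" and G :: "'g monoid" (structure)
    and n :: nat and E :: "int \<Rightarrow> int \<Rightarrow> 'r \<Rightarrow> 'g" and S :: "int \<Rightarrow> 'v \<times> 'r \<Rightarrow> 'g"
    and H :: "'h monoid" and \<epsilon> :: "'h \<Rightarrow> 'g" +
  assumes rank: "4 \<le> n"
    and disjoint: "root_pair n i j \<Longrightarrow> root_pair n i k \<Longrightarrow> root_pair n i h \<Longrightarrow> root_pair n j k \<Longrightarrow>
      root_pair n j h \<Longrightarrow> root_pair n k h \<Longrightarrow> comm_lift (E i j a) (E k h b) = \<one>\<^bsub>H\<^esub>"
begin

lemma root_pair_neq:
  "root_pair n i j \<Longrightarrow> i \<noteq> j" "root_pair n i j \<Longrightarrow> i \<noteq> - j" "root_pair n i j \<Longrightarrow> - i \<noteq> j"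
  "i \<in> index_set n \<Longrightarrow> i \<noteq> 0"
  by (auto simp: root_pair_def index_set_def)

text \<open>
  If some \<open>l\<close> avoids all four indices, then \<open>E h k b = [E h l 1, E l k b]\<close>, and the conditions on
  \<open>h\<close> and \<open>k\<close> make both factors commute with \<open>E i j a\<close>. Otherwise the four indices are
  distinct up to sign.
\<close>

lemma comm_lift_E_E:
  assumes ij: "root_pair n i j" and hk: "root_pair n h k"
    and ne: "h \<noteq> j" "h \<noteq> - i" "k \<noteq> i" "k \<noteq> - j"
  shows "comm_lift (E i j a) (E h k b) = \<one>\<^bsub>H\<^esub>"
proof (cases "\<exists>l\<in>index_set n. \<bar>l\<bar> \<notin> {\<bar>i\<bar>, \<bar>j\<bar>, \<bar>h\<bar>, \<bar>k\<bar>}")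
  case True
  then obtain l where "l \<in> index_set n" "\<bar>l\<bar> \<noteq> \<bar>i\<bar>" "\<bar>l\<bar> \<noteq> \<bar>j\<bar>" "\<bar>l\<bar> \<noteq> \<bar>h\<bar>" "\<bar>l\<bar> \<noteq> \<bar>k\<bar>"
    by auto
  then have l: "root_pair n h l" "root_pair n l k" "root_pair n l i" "root_pair n l j"
    using ij hk by (auto simp: root_pair_def)
  note pr = root_pair_neq ij hk l root_pairD(1-3)[OF ij] root_pairD(1-3)[OF hk] l[THEN root_pair_sym]
  have "comm_lift (E i j a) (group_comm G (E h l 1) (E l k b)) = \<one>\<^bsub>H\<^esub>"
    by (rule comm_lift_group_comm_trivial) (simp_all add: comm_E_E pr ne)
  then show ?thesis
    using comm_E_E_mult[OF l(1,2) hk, of 1 b] by simp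
next
  case False
  have *: "\<exists>l\<in>index_set n. \<bar>l\<bar> \<noteq> \<bar>p\<bar> \<and> \<bar>l\<bar> \<noteq> \<bar>q\<bar> \<and> \<bar>l\<bar> \<noteq> \<bar>r\<bar>" for p q r
    using obtain_index[OF rank] by metis
  have "\<bar>i\<bar> \<noteq> \<bar>h\<bar>" "\<bar>i\<bar> \<noteq> \<bar>k\<bar>" "\<bar>j\<bar> \<noteq> \<bar>h\<bar>" "\<bar>j\<bar> \<noteq> \<bar>k\<bar>"
    using False *[of i j k] *[of i j h] by auto
  then show ?thesis
    using ij hk by (intro disjoint) (auto simp: root_pair_def)
qed

text \<open>
  Only three indices are involved, so the factorisation \<open>E j k a = [E j l 1, E l k a]\<close> is always
  available.
\<close>

lemma comm_lift_S_E:
  assumes i: "i \<in> index_set n" and \<xi>: "\<xi> \<in> L" and jk: "root_pair n j k" and ne: "j \<noteq> - i" "k \<noteq> i"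
  shows "comm_lift (S i \<xi>) (E j k a) = \<one>\<^bsub>H\<^esub>"
proof -
  obtain l where "l \<in> index_set n" "\<bar>l\<bar> \<noteq> \<bar>i\<bar>" "\<bar>l\<bar> \<noteq> \<bar>j\<bar>" "\<bar>l\<bar> \<noteq> \<bar>k\<bar>"
    using obtain_index[OF rank] .
  then have l: "root_pair n j l" "root_pair n l k" "root_pair n i l"
    using i jk by (auto simp: root_pair_def)
  have "comm_lift (S i \<xi>) (group_comm G (E j l 1) (E l k a)) = \<one>\<^bsub>H\<^esub>"
    by (rule comm_lift_group_comm_trivial)
      (simp_all add: comm_S_E i \<xi> ne jk l l[THEN root_pair_sym] root_pair_neq)
  then show ?thesis
    using comm_E_E_mult[OF l(1,2) jk, of 1 a] by simp
qed

lemma comm_lift_E_S: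
  assumes "i \<in> index_set n" "\<xi> \<in> L" "root_pair n j k" "j \<noteq> - i" "k \<noteq> i"
  shows "comm_lift (E j k a) (S i \<xi>) = \<one>\<^bsub>H\<^esub>"
  by (rule comm_lift_sym_one[OF comm_lift_S_E]) (use assms in simp_all)

lemma commuteI:
  "comm_lift (\<epsilon> x) (\<epsilon> y) = \<one>\<^bsub>H\<^esub> \<Longrightarrow> x \<in> carrier H \<Longrightarrow> y \<in> carrier H \<Longrightarrow> x \<otimes>\<^bsub>H\<^esub> y = y \<otimes>\<^bsub>H\<^esub> x"
  by (simp add: commute_iff_comm_lift)

definition off :: "int \<Rightarrow> int \<Rightarrow> int" where
  "off i j = (SOME m. m \<in> index_set n \<and> \<bar>m\<bar> \<noteq> \<bar>i\<bar> \<and> \<bar>m\<bar> \<noteq> \<bar>j\<bar>)"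

lemma root_pair_off:
  assumes "i \<in> index_set n" "j \<in> index_set n"
  shows "root_pair n i (off i j)" "root_pair n (off i j) j"
proof -
  have "\<exists>m. m \<in> index_set n \<and> \<bar>m\<bar> \<noteq> \<bar>i\<bar> \<and> \<bar>m\<bar> \<noteq> \<bar>j\<bar>"
    using obtain_index[OF rank, of i j j] by metis
  from someI_ex[OF this] show "root_pair n i (off i j)" "root_pair n (off i j) j"
    using assms by (simp_all add: off_def[symmetric] root_pair_def)
qed

lemma obtain_third:
  assumes "root_pair n i j" "root_pair n k i" "root_pair n k j"
  obtains l where "root_pair n i l" "root_pair n l j" "root_pair n k l"
  using obtain_index[OF rank, of i j k] assms by (metis root_pair_def)

subsection \<open>Lifts of the long root elements\<close>

text \<open>
  The Hall-Witt identity for \<open>E i k a\<close>, \<open>E k l b\<close> and \<open>E l j d\<close>, the first and the last of which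
  have commuting lifts. Taking \<open>b = 1\<close> or \<open>a = 1\<close> shows that the commutator depends neither on the
  middle index nor on how the product of the parameters is split.
\<close>

lemma comm_lift_E_E_shift:
  assumes "root_pair n i j" "root_pair n i k" "root_pair n i l"
    "root_pair n j k" "root_pair n j l" "root_pair n k l"
  shows "comm_lift (E i k a) (E k j (b * d)) = comm_lift (E i l (a * b)) (E l j d)"
proof -
  note pr = root_pair_neq assms assms[THEN root_pair_sym] assms[THEN root_pairD(2)] assms[THEN root_pairD(3)]
  have "comm_lift (E i k a) (group_comm G (E k l b) (E l j d)) =
      comm_lift (group_comm G (E i k a) (E k l b)) (E l j d)"
    by (rule comm_lift_witt_simple) (simp_all add: comm_E_E_mult comm_lift_E_E pr)
  with pr show ?thesis
    by (simp add: comm_E_E_mult)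
qed

definition Y :: "int \<Rightarrow> int \<Rightarrow> 'r \<Rightarrow> 'h" where
  "Y i j a = comm_lift (E i (off i j) 1) (E (off i j) j a)"

text \<open>
  The shift needs middle indices that differ in absolute value, so the passage from \<open>k\<close> to
  \<open>off i j\<close> goes through a third index when they agree up to sign.
\<close>

lemma comm_lift_E_E_mult:
  assumes ij: "root_pair n i j" and "root_pair n i k" "root_pair n k j"
  shows "comm_lift (E i k a) (E k j b) = Y i j (a * b)"
proof -
  let ?o = "off i j"
  note o = root_pair_off[OF root_pairD(2,3)[OF ij]]
  have ki: "root_pair n k i" using assms(2) by (rule root_pair_sym)
  obtain l where l: "root_pair n i l" "root_pair n l j" "root_pair n k l"
    using obtain_third[OF ij ki assms(3)] .
  have lk: "comm_lift (E i l 1) (E l j (a * b)) = comm_lift (E i k a) (E k j b)"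
    using comm_lift_E_E_shift[of i j l k 1 a b] assms l by (simp add: root_pair_sym)
  show ?thesis
  proof (cases "\<bar>?o\<bar> = \<bar>k\<bar>")
    case False
    then have "root_pair n ?o k"
      using o(1) assms(2) by (simp add: root_pair_def)
    then show ?thesis
      using comm_lift_E_E_shift[of i j ?o k 1 a b] assms o by (simp add: root_pair_sym Y_def)
  next
    case True
    then have "root_pair n ?o l"
      using o(1) l(1,3) by (simp add: root_pair_def)
    then show ?thesis
      using comm_lift_E_E_shift[of i j ?o l 1 1 "a * b"] assms l o by (simp add: root_pair_sym Y_def lk)
  qed
qed

lemma Y_closed [simp]: "root_pair n i j \<Longrightarrow> Y i j a \<in> carrier H"
  and ext_Y [simp]: "root_pair n i j \<Longrightarrow> \<epsilon> (Y i j a) = E i j a"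
  using root_pair_off[OF root_pairD(2,3)] comm_E_E_mult[of i "off i j" j 1 a]
  by (simp_all add: Y_def)

lemma Y_add:
  assumes ij: "root_pair n i j"
  shows "Y i j a \<otimes>\<^bsub>H\<^esub> Y i j b = Y i j (a + b)"
proof -
  let ?o = "off i j"
  note o = root_pair_off[OF root_pairD(2,3)[OF ij]]
  have "comm_lift (E ?o j a) (E i j b) = \<one>\<^bsub>H\<^esub>"
    by (rule comm_lift_E_E) (simp_all add: ij o root_pair_neq root_pairD(1-3)[OF ij] o[THEN root_pair_sym])
  then have "Y i j (a + b) = Y i j a \<otimes>\<^bsub>H\<^esub> Y i j b"
    using comm_lift_mult_right[of "E i ?o 1" "E ?o j a" "E ?o j b"] ij o
    by (simp add: Y_def[symmetric] E_add comm_E_E_mult)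
  then show ?thesis ..
qed

lemma Y_zero: "root_pair n i j \<Longrightarrow> Y i j 0 = \<one>\<^bsub>H\<^esub>"
  using Y_add[of i j 0 0] by (simp add: H.l_cancel_one)

lemma inv_Y: "root_pair n i j \<Longrightarrow> inv\<^bsub>H\<^esub> Y i j a = Y i j (- a)"
  using Y_add[of i j "- a" a] by (intro H.inv_equality) (simp_all add: Y_zero)

lemma Y_minus:
  assumes ij: "root_pair n i j"
  shows "Y i j a = Y (- j) (- i) (sgn_ix (- j) * bar a * sgn_ix i)"
proof -
  let ?o = "off i j"
  note o = root_pair_off[OF root_pairD(2,3)[OF ij]]
  let ?b = "sgn_ix (- j) * bar a * sgn_ix ?o" and ?c = "sgn_ix (- ?o) * bar 1 * sgn_ix i"
  have "Y i j a = comm_lift (E (- ?o) (- i) ?c) (E (- j) (- ?o) ?b)"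
    using o by (simp only: Y_def E_minus[OF o(1), of 1] E_minus[OF o(2), of a])
  also have "\<dots> = inv\<^bsub>H\<^esub> comm_lift (E (- j) (- ?o) ?b) (E (- ?o) (- i) ?c)"
    using o ij by (simp add: inv_comm_lift root_pair_sym)
  also have "\<dots> = inv\<^bsub>H\<^esub> Y (- j) (- i) (?b * ?c)"
    using o ij by (simp add: comm_lift_E_E_mult root_pair_sym)
  also have "?b * ?c = - (sgn_ix (- j) * bar a * sgn_ix i)"
    using root_pairD(4)[OF o(2)] by (simp add: mult.assoc sgn_minus_e_mult sgn_minus_mult)
  finally show ?thesis
    using ij by (simp add: inv_Y root_pair_sym)
qed

subsection \<open>Lifts of the short root elements\<close>

lemma comm_E_E_opp:
  assumes "root_pair n i j"
  shows "group_comm G (E i j a) (E j (- i) b) =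
    S i (0, - (sgn_ix (- i) * (e * (a * b))) + bar (- (sgn_ix (- i) * (e * (a * b)))))"
  using comm_E_E_short[OF assms] R9_parameter[OF root_pairD(4)[OF assms]] by simp

text \<open>
  The same identity as for long roots, now with the triple commutator in a short root subgroup.
\<close>

lemma comm_lift_E_E_opp_shift:
  assumes "root_pair n j k" "root_pair n j l" "root_pair n k l"
  shows "comm_lift (E j k a) (E k (- j) (b * d)) = comm_lift (E j l (a * b)) (E l (- j) d)"
proof -
  note pr = root_pair_neq assms assms[THEN root_pair_sym] assms[THEN root_pairD(2)] assms[THEN root_pairD(3)]
  have "comm_lift (E j k a) (group_comm G (E k l b) (E l (- j) d)) =
      comm_lift (group_comm G (E j k a) (E k l b)) (E l (- j) d)"
  proof (rule comm_lift_witt_simple)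
    have "comm_lift (E k (- j) (b * d)) (S j (0, s + bar s)) = \<one>\<^bsub>H\<^esub>" for s
      by (rule comm_lift_E_S) (simp_all add: pr)
    from this[of "- (sgn_ix (- j) * (e * (a * b * d)))"]
    show "comm_lift (group_comm G (E k l b) (E l (- j) d))
      (group_comm G (group_comm G (E j k a) (E k l b)) (E l (- j) d)) = \<one>\<^bsub>H\<^esub>"
      by (simp add: comm_E_E_mult comm_E_E_opp pr)
  qed (simp_all add: comm_E_E_mult comm_lift_E_E pr)
  with pr show ?thesis
    by (simp add: comm_E_E_mult)
qed

text \<open>
  The lift of \<open>S j (0, s + bar s)\<close> that long root elements provide. The factor \<open>sgn_ix j\<close>
  normalises the parameter.
\<close>

definition T :: "int \<Rightarrow> 'r \<Rightarrow> 'h" where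
  "T j s = comm_lift (E j (off j j) 1) (E (off j j) (- j) (sgn_ix j * s))"

lemma comm_lift_E_E_opp:
  assumes jk: "root_pair n j k"
  shows "comm_lift (E j k a) (E k (- j) b) = T j (- (sgn_ix (- j) * (e * (a * b))))"
proof -
  let ?o = "off j j"
  have j: "j \<in> index_set n" "j \<noteq> 0" using root_pairD[OF jk] by simp_all
  note o = root_pair_off[OF j(1) j(1)]
  have T: "T j (- (sgn_ix (- j) * (e * (a * b)))) = comm_lift (E j ?o 1) (E ?o (- j) (a * b))"
    by (simp add: T_def sgn_minus_e_mult j(2))
  obtain l where l: "root_pair n j l" "root_pair n k l"
    using obtain_third[OF jk root_pair_sym[OF jk]] obtain_index[OF rank, of j k k] jk
    by (metis root_pair_def)
  have lk: "comm_lift (E j l 1) (E l (- j) (a * b)) = comm_lift (E j k a) (E k (- j) b)"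
    using comm_lift_E_E_opp_shift[of j l k 1 a b] l jk by (simp add: root_pair_sym)
  show ?thesis
  proof (cases "\<bar>?o\<bar> = \<bar>k\<bar>")
    case False
    then have "root_pair n ?o k"
      using o(1) jk by (simp add: root_pair_def)
    then show ?thesis
      using comm_lift_E_E_opp_shift[of j ?o k 1 a b] jk o by (simp add: root_pair_sym T)
  next
    case True
    then have "root_pair n ?o l"
      using o(1) l by (simp add: root_pair_def)
    then show ?thesis
      using comm_lift_E_E_opp_shift[of j ?o l 1 1 "a * b"] l o by (simp add: root_pair_sym T lk)
  qed
qed

lemma T_closed [simp]: "j \<in> index_set n \<Longrightarrow> T j s \<in> carrier H"
  using root_pair_off[of j j] by (simp add: T_def)

lemma ext_T [simp]:
  assumes "j \<in> index_set n"
  shows "\<epsilon> (T j s) = S j (0, s + bar s)"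
  using root_pair_off[OF assms assms] assms root_pair_neq(4)[OF assms]
  by (simp add: T_def comm_E_E_opp sgn_minus_e_mult)

lemma T_add:
  assumes j: "j \<in> index_set n"
  shows "T j (s + t) = T j s \<otimes>\<^bsub>H\<^esub> T j t"
proof -
  let ?o = "off j j"
  note o = root_pair_off[OF j j]
  have c: "comm_lift (E ?o (- j) (sgn_ix j * s)) (S j (0, t + bar t)) = \<one>\<^bsub>H\<^esub>"
    by (rule comm_lift_E_S) (simp_all add: j o root_pair_neq)
  have "group_comm G (E j ?o 1) (E ?o (- j) (sgn_ix j * t)) = S j (0, t + bar t)"
    using comm_E_E_opp[OF o(1), of 1 "sgn_ix j * t"] root_pair_neq(4)[OF j] by (simp add: sgn_minus_e_mult)
  then show ?thesis
    using comm_lift_mult_right[of "E j ?o 1" "E ?o (- j) (sgn_ix j * s)" "E ?o (- j) (sgn_ix j * t)"] o c j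
    by (simp add: T_def E_add distrib_left)
qed

lemma T_zero: "j \<in> index_set n \<Longrightarrow> T j 0 = \<one>\<^bsub>H\<^esub>"
  using T_add[of j 0 0] by (simp add: H.r_cancel_one')

lemma inv_T: "j \<in> index_set n \<Longrightarrow> inv\<^bsub>H\<^esub> T j s = T j (- s)"
  using T_add[of j "- s" s] by (intro H.inv_equality) (simp_all add: T_zero)

lemma commute_E_S:
  assumes "i \<in> index_set n" "\<xi> \<in> L" "root_pair n j k" "j \<noteq> - i" "k \<noteq> i"
  shows "E j k a \<otimes>\<^bsub>G\<^esub> S i \<xi> = S i \<xi> \<otimes>\<^bsub>G\<^esub> E j k a"
  using comm_S_E[OF assms, of a] assms by (simp add: group_comm_eq_one_iff)

lemma comm_S_E_one:
  assumes "root_pair n k j" "(u, a) \<in> L"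
  shows "group_comm G (S k (u, a)) (E (- k) (- j) b) =
    S j (heis_act bar act (u, - bar a) b) \<otimes>\<^bsub>G\<^esub> E k (- j) (sgn_ix k * a * b)"
proof -
  note pr = root_pair_neq assms root_pair_sym[OF assms(1)] root_pairD(2,3)[OF assms(1)]
  have "E k (- j) (sgn_ix k * a * b) \<otimes>\<^bsub>G\<^esub> S j (heis_act bar act (u, - bar a) b) =
    S j (heis_act bar act (u, - bar a) b) \<otimes>\<^bsub>G\<^esub> E k (- j) (sgn_ix k * a * b)"
    by (rule commute_E_S) (simp_all add: pr)
  then show ?thesis
    using comm_S_E_opp[of k "- j" u a b] assms by simp
qed

lemma S_eq:
  assumes "root_pair n k j" "(u, a) \<in> L"
  shows "S j (u, a) = group_comm G (S k (u, - bar a)) (E (- k) (- j) 1) \<otimes>\<^bsub>G\<^esub> E k (- j) (sgn_ix k * bar a)"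
  using assms comm_S_E_one[of k j u "- bar a" 1] root_pairD(2,3)[OF assms(1)]
  by (simp add: m_assoc E_add E_zero)

text \<open>
  Here the value of the commutator is found without any comparison of choices: \<open>S j (v, b)\<close> is
  replaced by \<open>[S l (v, - bar b), E (- l) (- j) 1]\<close>, up to a factor that commutes with
  \<open>S k (u, a)\<close>, and the Hall-Witt identity leaves a commutator of long root elements.
\<close>

lemma comm_lift_S_S:
  assumes kj: "root_pair n k j" and ua: "(u, a) \<in> L" and vb: "(v, b) \<in> L"
  shows "comm_lift (S k (u, a)) (S j (v, b)) = Y k (- j) (sgn_ix k * B u v)"
proof -
  obtain l where l: "root_pair n k l" "root_pair n l j"
    using obtain_index[OF rank, of j k k] kj by (metis root_pair_def)
  note rp = kj l
  note pr = root_pair_neq rp rp[THEN root_pair_sym] rp[THEN root_pairD(2)] rp[THEN root_pairD(3)]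
  let ?x = "S k (u, a)" and ?y = "S l (v, - bar b)" and ?z = "E (- l) (- j) 1"
  have yz: "group_comm G ?y ?z = S j (v, b) \<otimes>\<^bsub>G\<^esub> E l (- j) (sgn_ix l * - bar b)"
    using comm_S_E_one[of l j v "- bar b" 1] vb pr by simp
  have xy: "group_comm G ?x ?y = E k (- l) (sgn_ix k * B u v)"
    using comm_S_S[of k l u a v "- bar b"] ua vb pr by simp
  have xyz: "group_comm G (group_comm G ?x ?y) ?z = E k (- j) (sgn_ix k * B u v)"
    using comm_E_E_mult[of k "- l" "- j" "sgn_ix k * B u v" 1] pr by (simp add: xy)
  have "comm_lift ?x (S j (v, b)) = comm_lift ?x (group_comm G ?y ?z)"
    unfolding S_eq[OF l(2) vb]
    by (rule comm_lift_mult_right_trivial) (simp_all add: pr comm_lift_S_E ua vb)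
  also have "\<dots> = comm_lift (group_comm G ?x ?y) ?z"
  proof (rule comm_lift_witt_simple)
    have "comm_lift (E k (- l) c) (S j (v, b) \<otimes>\<^bsub>G\<^esub> E l (- j) d) = \<one>\<^bsub>H\<^esub>" for c d
      by (subst comm_lift_mult_right_trivial) (simp_all add: pr vb comm_lift_E_S comm_lift_E_E)
    then show "comm_lift (group_comm G ?x ?y) (group_comm G ?y ?z) = \<one>\<^bsub>H\<^esub>"
      by (simp only: xy yz)
    have "comm_lift (S j (v, b) \<otimes>\<^bsub>G\<^esub> E l (- j) d) (E k (- j) c) = \<one>\<^bsub>H\<^esub>" for c d
      by (subst comm_lift_mult_left_trivial) (simp_all add: pr vb comm_lift_S_E comm_lift_E_E)
    then show "comm_lift (group_comm G ?y ?z) (group_comm G (group_comm G ?x ?y) ?z) = \<one>\<^bsub>H\<^esub>"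
      by (simp only: xyz yz)
  qed (simp_all add: pr ua vb comm_lift_S_E)
  also have "\<dots> = Y k (- j) (sgn_ix k * B u v)"
    using comm_lift_E_E_mult[of k "- j" "- l" "sgn_ix k * B u v" 1] pr by (simp add: xy)
  finally show ?thesis .
qed

text \<open>
  The relation for the commutator of \<open>S k (twist \<xi>)\<close> and \<open>E (- k) (- j) 1\<close>, solved for the factor
  \<open>S j \<xi>\<close>.
\<close>

definition Z :: "int \<Rightarrow> int \<Rightarrow> 'v \<times> 'r \<Rightarrow> 'h" where
  "Z k j \<xi> = comm_lift (S k (twist \<xi>)) (E (- k) (- j) 1) \<otimes>\<^bsub>H\<^esub> Y k (- j) (sgn_ix k * bar (snd \<xi>))"

lemma Z_closed [simp]: "root_pair n k j \<Longrightarrow> \<xi> \<in> L \<Longrightarrow> Z k j \<xi> \<in> carrier H"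
  by (simp add: Z_def root_pairD)

lemma ext_Z [simp]:
  assumes "root_pair n k j" "\<xi> \<in> L"
  shows "\<epsilon> (Z k j \<xi>) = S j \<xi>"
  using assms S_eq[of k j "fst \<xi>" "snd \<xi>"] root_pairD[OF assms(1)] twist_closed[OF assms(2)]
  by (simp add: Z_def twist_def)

lemma comm_lift_S_E_one:
  assumes "root_pair n k j" "(u, a) \<in> L"
  shows "comm_lift (S k (u, a)) (E (- k) (- j) 1) = Z k j (u, - bar a) \<otimes>\<^bsub>H\<^esub> Y k (- j) (sgn_ix k * a)"
  using assms root_pairD[OF assms(1)] by (simp add: Z_def H.m_assoc Y_add Y_zero)

lemma commute_Y_Z:
  assumes "root_pair n i h" "root_pair n k j" "\<xi> \<in> L" "i \<noteq> - j" "h \<noteq> j"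
  shows "Y i h a \<otimes>\<^bsub>H\<^esub> Z k j \<xi> = Z k j \<xi> \<otimes>\<^bsub>H\<^esub> Y i h a"
  by (rule commuteI) (use assms root_pairD[OF assms(2)] in \<open>simp_all add: comm_lift_E_S\<close>)

lemma commute_Y_Y:
  assumes "root_pair n i j" "root_pair n h k" "h \<noteq> j" "h \<noteq> - i" "k \<noteq> i" "k \<noteq> - j"
  shows "Y i j a \<otimes>\<^bsub>H\<^esub> Y h k b = Y h k b \<otimes>\<^bsub>H\<^esub> Y i j a"
  by (rule commuteI) (use assms in \<open>simp_all add: comm_lift_E_E\<close>)

lemma commute_Y_T:
  assumes "root_pair n i h" "j \<in> index_set n" "i \<noteq> - j" "h \<noteq> j"
  shows "Y i h a \<otimes>\<^bsub>H\<^esub> T j s = T j s \<otimes>\<^bsub>H\<^esub> Y i h a"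
  by (rule commuteI) (use assms in \<open>simp_all add: comm_lift_E_S\<close>)

text \<open>
  Expanding the commutator with \<open>S k (twist \<xi>) S k (twist \<eta>)\<close> produces the correction
  \<open>\<langle>S k (twist \<xi>), S j \<eta>\<rangle>\<close>, known by \<open>comm_lift_S_S\<close>; it is the long root element that
  the cocycle \<open>B u v\<close> of the Heisenberg group contributes on the other side.
\<close>

lemma Z_add:
  assumes kj: "root_pair n k j" and \<eta>: "\<eta> \<in> L" and \<xi>: "\<xi> \<in> L"
  shows "Z k j (heis_add B \<eta> \<xi>) = Z k j \<eta> \<otimes>\<^bsub>H\<^esub> Z k j \<xi>"
proof -
  note pr = root_pair_neq kj kj[THEN root_pair_sym] kj[THEN root_pairD(2)] kj[THEN root_pairD(3)]
  obtain u a v b where t: "twist \<xi> = (u, a)" "twist \<eta> = (v, b)"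
    by (cases "twist \<xi>"; cases "twist \<eta>")
  have ua: "(u, a) \<in> L" and vb: "(v, b) \<in> L"
    using twist_closed[OF \<xi>] twist_closed[OF \<eta>] t by simp_all
  have \<xi>': "\<xi> = (u, - bar a)" and \<eta>': "\<eta> = (v, - bar b)"
    using t twist_twist[of \<xi>] twist_twist[of \<eta>] by simp_all
  let ?h = "E (- k) (- j) 1"
  define A where "A = sgn_ix k * a"
  define C where "C = sgn_ix k * b"
  define D where "D = sgn_ix k * B u v"
  have sum: "heis_add B (u, a) (v, b) = (u + v, a + b + B u v)"
    by (simp add: heis_add_def)
  have tw: "(u + v, - bar (a + b + B u v)) = heis_add B \<eta> \<xi>"
    by (simp add: heis_add_def \<xi>' \<eta>' bar_B)
  have sumL: "(u + v, a + b + B u v) \<in> L"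
    using L_heis_add[OF ua vb] by (simp add: sum)
  have "comm_lift (S k (u, a)) (group_comm G (S k (v, b)) ?h) = comm_lift (S k (u, a)) (S j (v, - bar b))"
    using comm_S_E_one[OF kj vb, of 1] pr ua vb
    by (simp add: comm_lift_mult_right_trivial comm_lift_S_E)
  also have "\<dots> = Y k (- j) D"
    using comm_lift_S_S[OF kj ua, of v "- bar b"] vb by (simp add: D_def)
  finally have 1: "comm_lift (S k (u, a)) (group_comm G (S k (v, b)) ?h) = Y k (- j) D" .
  have "Z k j (heis_add B \<eta> \<xi>) \<otimes>\<^bsub>H\<^esub> Y k (- j) (A + C + D) =
      comm_lift (S k (u + v, a + b + B u v)) ?h"
    unfolding comm_lift_S_E_one[OF kj sumL] tw by (simp add: A_def C_def D_def distrib_left)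
  also have "\<dots> = comm_lift (S k (u, a) \<otimes>\<^bsub>G\<^esub> S k (v, b)) ?h"
    using S_add[of k "(u, a)" "(v, b)"] ua vb pr by (simp add: sum)
  also have "\<dots> = Y k (- j) D \<otimes>\<^bsub>H\<^esub> (Z k j \<eta> \<otimes>\<^bsub>H\<^esub> Y k (- j) C) \<otimes>\<^bsub>H\<^esub> (Z k j \<xi> \<otimes>\<^bsub>H\<^esub> Y k (- j) A)"
    using ua vb pr 1
    by (simp add: comm_lift_mult_left comm_lift_S_E_one \<xi>' \<eta>' A_def C_def)
  also have "\<dots> = (Y k (- j) D \<otimes>\<^bsub>H\<^esub> Z k j \<eta>) \<otimes>\<^bsub>H\<^esub> ((Y k (- j) C \<otimes>\<^bsub>H\<^esub> Z k j \<xi>) \<otimes>\<^bsub>H\<^esub> Y k (- j) A)"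
    using \<eta> \<xi> pr by (simp add: H.m_assoc)
  also have "Y k (- j) C \<otimes>\<^bsub>H\<^esub> Z k j \<xi> = Z k j \<xi> \<otimes>\<^bsub>H\<^esub> Y k (- j) C"
    by (rule commute_Y_Z) (simp_all add: pr \<xi>)
  also have "Y k (- j) D \<otimes>\<^bsub>H\<^esub> Z k j \<eta> = Z k j \<eta> \<otimes>\<^bsub>H\<^esub> Y k (- j) D"
    by (rule commute_Y_Z) (simp_all add: pr \<eta>)
  also have "Z k j \<eta> \<otimes>\<^bsub>H\<^esub> Y k (- j) D \<otimes>\<^bsub>H\<^esub> (Z k j \<xi> \<otimes>\<^bsub>H\<^esub> Y k (- j) C \<otimes>\<^bsub>H\<^esub> Y k (- j) A) =
     Z k j \<eta> \<otimes>\<^bsub>H\<^esub> (Y k (- j) D \<otimes>\<^bsub>H\<^esub> Z k j \<xi>) \<otimes>\<^bsub>H\<^esub> Y k (- j) (C + A)"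
    using \<eta> \<xi> pr by (simp add: H.m_assoc Y_add)
  also have "Y k (- j) D \<otimes>\<^bsub>H\<^esub> Z k j \<xi> = Z k j \<xi> \<otimes>\<^bsub>H\<^esub> Y k (- j) D"
    by (rule commute_Y_Z) (simp_all add: pr \<xi>)
  also have "Z k j \<eta> \<otimes>\<^bsub>H\<^esub> (Z k j \<xi> \<otimes>\<^bsub>H\<^esub> Y k (- j) D) \<otimes>\<^bsub>H\<^esub> Y k (- j) (C + A) =
     Z k j \<eta> \<otimes>\<^bsub>H\<^esub> Z k j \<xi> \<otimes>\<^bsub>H\<^esub> Y k (- j) (A + C + D)"
    using \<eta> \<xi> pr by (simp add: H.m_assoc Y_add algebra_simps)
  finally show ?thesis
    using \<eta> \<xi> pr by simp
qed

text \<open>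
  For \<open>\<xi> = (0, s + bar s)\<close> the short root element in the definition of \<open>Z\<close> is itself a commutator
  \<open>[x, y]\<close> of long root elements, so \<open>Z\<close> is given by a triple commutator of long root elements,
  which \<open>comm_lift_nested\<close> evaluates. Its middle factor is \<open>T j (- s)\<close> and the outer ones cancel
  against the long factor in the definition of \<open>Z\<close>.
\<close>

lemma Z_min_eq_T:
  assumes kj: "root_pair n k j"
  shows "Z k j (0, s + bar s) = T j s"
proof -
  obtain l where l: "root_pair n k l" "root_pair n l j"
    using obtain_index[OF rank, of j k k] kj by (metis root_pair_def)
  note rp = kj l
  note pr = root_pair_neq rp rp[THEN root_pair_sym] rp[THEN root_pairD(2)] rp[THEN root_pairD(3)]
  have nz: "k \<noteq> 0" "l \<noteq> 0" "j \<noteq> 0" using pr by simp_all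
  note sgn = sgn_minus_e_mult[OF nz(1)] sgn_minus_e_mult[OF nz(2)] sgn_minus_e_mult[OF nz(3)]
  let ?b = "- (sgn_ix k * s)" and ?c = "- (sgn_ix (- l) * e * sgn_ix k)"
  let ?x = "E k l 1" and ?y = "E l (- k) ?b" and ?z = "E (- k) (- j) 1"
  let ?x' = "E (- l) (- j) ?c" and ?y' = "E l (- j) (sgn_ix k * s)"
  have x_minus: "?x = E (- l) (- k) (- ?c)"
    using E_minus[OF l(1), of 1] by simp
  have y_minus: "?y = E k (- l) (- (sgn_ix k * bar (sgn_ix k * s) * sgn_ix l))"
    using E_minus[of l "- k" ?b] pr by simp
  have x'_minus: "?x' = E j l (sgn_ix j * bar ?c * sgn_ix (- l))"
    using E_minus[of "- l" "- j" ?c] pr by simp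
  have bar_c: "bar ?c * sgn_ix (- l) * (sgn_ix k * s) = - s"
  proof -
    have "bar (sgn_ix (- l) * e * sgn_ix k) * sgn_ix (- l) = bar (e * sgn_ix k)"
      by (simp add: bar_mult mult.assoc bar_sgn_mult)
    also have "\<dots> = bar (sgn_ix k) * e_inv"
      by (simp add: bar_mult)
    finally have "bar ?c * sgn_ix (- l) = - (bar (sgn_ix k) * e_inv)"
      by simp
    then show ?thesis
      by (simp add: mult.assoc bar_sgn_mult)
  qed
  have zx: "group_comm G ?z ?x = ?x'"
  proof -
    have "group_comm G ?x ?z = E (- l) (- j) (- ?c)"
      unfolding x_minus using comm_E_E_mult[of "- l" "- k" "- j" "- ?c" 1] pr by simp
    then show ?thesis
      using inv_group_comm[of ?x ?z] pr by (simp add: inv_E)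
  qed
  have zy: "group_comm G ?z ?y = ?y'"
  proof -
    have "group_comm G ?y ?z = E l (- j) ?b"
      using comm_E_E_mult[of l "- k" "- j" ?b 1] pr by simp
    then show ?thesis
      using inv_group_comm[of ?y ?z] pr by (simp add: inv_E)
  qed
  have xy: "group_comm G ?x ?y = S k (0, - s + bar (- s))"
    using comm_E_E_opp[OF l(1), of 1 ?b] by (simp add: sgn)
  have lift_xy': "comm_lift ?x ?y' = Y k (- j) (sgn_ix k * s)"
    using comm_lift_E_E_mult[of k "- j" l 1 "sgn_ix k * s"] pr by simp
  have lift_x'y: "comm_lift ?x' ?y = Y k (- j) (sgn_ix k * bar s)"
  proof -
    have "- (sgn_ix k * bar (sgn_ix k * s) * sgn_ix l) * ?c = - (sgn_ix k * bar s)"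
      by (simp add: mult.assoc sgn bar_mult bar_sgn_mult)
    then have "comm_lift ?y ?x' = Y k (- j) (- (sgn_ix k * bar s))"
      unfolding y_minus
      using comm_lift_E_E_mult[of k "- j" "- l" "- (sgn_ix k * bar (sgn_ix k * s) * sgn_ix l)" ?c] pr by simp
    then show ?thesis
      using inv_comm_lift[of ?y ?x'] pr by (simp add: inv_Y)
  qed
  have lift_x'y': "comm_lift ?x' ?y' = T j (- s)"
    unfolding x'_minus using comm_lift_E_E_opp[OF root_pair_sym[OF l(2)], of _ "sgn_ix k * s"] bar_c
    by (simp add: mult.assoc sgn)
  have xy': "group_comm G ?x ?y' = E k (- j) (sgn_ix k * s)"
    using lift_xy' ext_comm_lift[of ?x ?y'] pr by simp
  have x'y: "group_comm G ?x' ?y = E k (- j) (sgn_ix k * bar s)"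
    using lift_x'y ext_comm_lift[of ?x' ?y] pr by simp
  have sL: "(0, - s + bar (- s)) \<in> L" by (rule L_min)
  \<comment> \<open>The simplifier must not normalise the parameter \<open>- s + bar (- s)\<close>: it would no longer match
    \<open>sL\<close>, so the rules are listed.\<close>
  have "comm_lift ?z (group_comm G ?x ?y) =
      comm_lift ?x (group_comm G ?z ?y) \<otimes>\<^bsub>H\<^esub>
      comm_lift (group_comm G ?z ?x) (group_comm G ?z ?y) \<otimes>\<^bsub>H\<^esub> comm_lift (group_comm G ?z ?x) ?y"
    by (rule comm_lift_nested; (unfold zx zy xy xy' x'y)?)
      (simp_all only: comm_lift_E_E comm_lift_E_S comm_lift_S_E sL pr E_closed root_pair_minus
        index_set_minus simp_thms minus_minus neg_equal_iff_equal neg_equal_zero equal_neg_zero)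
  then have zxy: "comm_lift ?z (S k (0, - s + bar (- s))) =
      Y k (- j) (sgn_ix k * s) \<otimes>\<^bsub>H\<^esub> T j (- s) \<otimes>\<^bsub>H\<^esub> Y k (- j) (sgn_ix k * bar s)"
    unfolding zx zy xy lift_xy' lift_x'y' lift_x'y .
  have "comm_lift (S k (0, - s + bar (- s))) ?z = inv\<^bsub>H\<^esub> comm_lift ?z (S k (0, - s + bar (- s)))"
    using pr sL by (simp only: inv_comm_lift S_closed E_closed root_pair_minus)
  also have "\<dots> = Y k (- j) (- (sgn_ix k * bar s)) \<otimes>\<^bsub>H\<^esub> (T j s \<otimes>\<^bsub>H\<^esub> Y k (- j) (- (sgn_ix k * s)))"
    unfolding zxy using pr by (simp add: H.inv_mult_group inv_Y inv_T)
  also have "T j s \<otimes>\<^bsub>H\<^esub> Y k (- j) (- (sgn_ix k * s)) = Y k (- j) (- (sgn_ix k * s)) \<otimes>\<^bsub>H\<^esub> T j s"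
    by (rule commute_Y_T[symmetric]) (simp_all add: pr)
  also have "Y k (- j) (- (sgn_ix k * bar s)) \<otimes>\<^bsub>H\<^esub> (Y k (- j) (- (sgn_ix k * s)) \<otimes>\<^bsub>H\<^esub> T j s) =
      Y k (- j) (sgn_ix k * (- s + bar (- s))) \<otimes>\<^bsub>H\<^esub> T j s"
    using pr by (simp add: Y_add algebra_simps flip: H.m_assoc)
  also have "\<dots> = T j s \<otimes>\<^bsub>H\<^esub> Y k (- j) (sgn_ix k * (- s + bar (- s)))"
    by (rule commute_Y_T) (simp_all add: pr)
  finally have "Z k j (0, - bar (- s + bar (- s))) \<otimes>\<^bsub>H\<^esub> Y k (- j) (sgn_ix k * (- s + bar (- s))) =
      T j s \<otimes>\<^bsub>H\<^esub> Y k (- j) (sgn_ix k * (- s + bar (- s)))"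
    unfolding comm_lift_S_E_one[OF kj sL] .
  moreover have "- bar (- s + bar (- s)) = s + bar s"
    by (simp add: add.commute)
  ultimately show ?thesis
    using pr by simp
qed

text \<open>
  The central computation. Writing \<open>E (- k) (- j) b = [E (- k) l b, E l (- j) 1]\<close>, the Hall-Witt
  identity expresses the commutator by the one that defines \<open>Z (- l) j\<close>, together with two
  corrections: a long root element, which cancels, and \<open>T j s\<close>. By \<open>Z_min_eq_T\<close> and \<open>Z_add\<close> the
  latter turns \<open>Z (- l) j (twist \<zeta>)\<close> into \<open>Z (- l) j \<zeta>\<close>. For \<open>b = 1\<close> this compares \<open>Z k j\<close> with
  \<open>Z (- l) j\<close>; for general \<open>b\<close> it is the commutator relation that the lifts have to satisfy.
\<close>

lemma comm_lift_S_E_opp_shift: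
  assumes kj: "root_pair n k j" and lj: "root_pair n l j" and kl: "root_pair n k l" and ua: "(u, a) \<in> L"
  shows "comm_lift (S k (u, a)) (E (- k) (- j) b) =
    Z (- l) j (heis_act bar act (u, - bar a) b) \<otimes>\<^bsub>H\<^esub> Y k (- j) (sgn_ix k * a * b)"
proof -
  note rp = kj lj kl
  note pr = root_pair_neq rp rp[THEN root_pair_sym] rp[THEN root_pairD(2)] rp[THEN root_pairD(3)]
  have nz: "k \<noteq> 0" "l \<noteq> 0" "j \<noteq> 0" using pr by simp_all
  note sgn = sgn_minus_e_mult[OF nz(1)] sgn_minus_e_mult[OF nz(2)] sgn_minus_e_mult[OF nz(3)]
    sgn_minus_mult[OF nz(1)] sgn_minus_mult[OF nz(2)] sgn_minus_mult[OF nz(3)]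
  define \<zeta> where "\<zeta> = heis_act bar act (u, - bar a) b"
  define A where "A = - (bar b * e_inv * bar a * b)"
  define s where "s = - (bar b * e_inv * a * b)"
  have \<zeta>: "\<zeta> = (act u b, A)" "\<zeta> \<in> L"
    using L_act[OF twist_L_closed[OF ua], of b]
    by (simp_all add: \<zeta>_def A_def heis_act_def mult.assoc)
  have bar_A: "bar A = s"
    by (simp add: A_def s_def bar_mult mult.assoc)
  define \<sigma> where "\<sigma> = sgn_ix (- l) * A"
  define \<tau> where "\<tau> = sgn_ix k * a * b"
  let ?x = "S k (u, a)" and ?y = "E (- k) l b" and ?z = "E l (- j) 1"
  have xy: "group_comm G ?x ?y = E k l \<tau> \<otimes>\<^bsub>G\<^esub> S (- l) \<zeta>"
    unfolding \<tau>_def \<zeta>_def by (rule comm_S_E_opp) (simp_all add: pr ua)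
  have yz: "group_comm G ?y ?z = E (- k) (- j) b"
    using comm_E_E_mult[of "- k" l "- j" b 1] pr by simp
  have lift_qz: "comm_lift (S (- l) \<zeta>) ?z = Z (- l) j (twist \<zeta>) \<otimes>\<^bsub>H\<^esub> Y (- l) (- j) \<sigma>"
    using comm_lift_S_E_one[of "- l" j "act u b" A] \<zeta> pr by (simp add: \<sigma>_def)
  have c_pqz: "comm_lift (E k l \<tau>) (group_comm G (S (- l) \<zeta>) ?z) = \<one>\<^bsub>H\<^esub>"
  proof -
    have "group_comm G (S (- l) \<zeta>) ?z = S j (twist \<zeta>) \<otimes>\<^bsub>G\<^esub> E (- l) (- j) \<sigma>"
    proof -
      have "group_comm G (S (- l) \<zeta>) ?z = \<epsilon> (comm_lift (S (- l) \<zeta>) ?z)"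
        using pr \<zeta>(2) by simp
      then show ?thesis
        unfolding lift_qz using pr \<zeta>(2) by simp
    qed
    then show ?thesis
      using pr \<zeta>(2) by (simp add: comm_lift_mult_right_trivial comm_lift_E_E comm_lift_E_S)
  qed
  have "comm_lift (E k l \<tau> \<otimes>\<^bsub>G\<^esub> S (- l) \<zeta>) ?z =
      Z (- l) j (twist \<zeta>) \<otimes>\<^bsub>H\<^esub> Y (- l) (- j) \<sigma> \<otimes>\<^bsub>H\<^esub> Y k (- j) \<tau>"
    using comm_lift_mult_left[of "E k l \<tau>" "S (- l) \<zeta>" ?z] c_pqz lift_qz
      comm_lift_E_E_mult[of k "- j" l \<tau> 1] pr \<zeta>(2) by simp
  also have "\<dots> = Y k (- j) \<tau> \<otimes>\<^bsub>H\<^esub> (Z (- l) j (twist \<zeta>) \<otimes>\<^bsub>H\<^esub> Y (- l) (- j) \<sigma>)"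
    by (rule commuteI[symmetric])
      (simp_all add: pr \<zeta>(2) comm_lift_mult_right_trivial comm_lift_E_E comm_lift_E_S)
  finally have lift_xyz: "comm_lift (group_comm G ?x ?y) ?z =
      Y k (- j) \<tau> \<otimes>\<^bsub>H\<^esub> (Z (- l) j (twist \<zeta>) \<otimes>\<^bsub>H\<^esub> Y (- l) (- j) \<sigma>)"
    unfolding xy .
  have xyz: "group_comm G (group_comm G ?x ?y) ?z =
      E k (- j) \<tau> \<otimes>\<^bsub>G\<^esub> (S j (twist \<zeta>) \<otimes>\<^bsub>G\<^esub> E (- l) (- j) \<sigma>)"
    using ext_comm_lift[of "group_comm G ?x ?y" ?z] pr \<zeta>(2) ua unfolding lift_xyz by simp
  have lift_yz_xyz: "comm_lift (group_comm G ?y ?z) (group_comm G (group_comm G ?x ?y) ?z) = T j s"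
  proof -
    have "comm_lift (E (- k) (- j) b) (S j (twist \<zeta>) \<otimes>\<^bsub>G\<^esub> E (- l) (- j) \<sigma>) = \<one>\<^bsub>H\<^esub>"
      using pr \<zeta>(2) by (simp add: comm_lift_mult_right_trivial comm_lift_E_E comm_lift_E_S)
    then have "comm_lift (group_comm G ?y ?z) (group_comm G (group_comm G ?x ?y) ?z) =
        comm_lift (E (- k) (- j) b) (E k (- j) \<tau>)"
      unfolding xyz yz by (rule comm_lift_mult_right_trivial) (simp_all add: pr \<zeta>(2))
    also have "E (- k) (- j) b = E j k (sgn_ix j * bar b * sgn_ix (- k))"
      using E_minus[of "- k" "- j" b] pr by simp
    also have "comm_lift \<dots> (E k (- j) \<tau>) = T j s"
      using comm_lift_E_E_opp[OF root_pair_sym[OF kj], of "sgn_ix j * bar b * sgn_ix (- k)" \<tau>]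
      by (simp add: \<tau>_def s_def mult.assoc sgn)
    finally show ?thesis .
  qed
  have lift_xy_yz: "comm_lift (group_comm G ?x ?y) (group_comm G ?y ?z) = Y (- l) (- j) (- \<sigma>)"
  proof -
    have "comm_lift (group_comm G ?x ?y) (group_comm G ?y ?z) = comm_lift (E k l \<tau>) (E (- k) (- j) b)"
      unfolding xy yz
      by (rule comm_lift_mult_left_trivial) (simp_all add: pr \<zeta>(2) comm_lift_S_E)
    also have "E k l \<tau> = E (- l) (- k) (sgn_ix (- l) * bar \<tau> * sgn_ix k)"
      by (rule E_minus[OF kl])
    also have "comm_lift \<dots> (E (- k) (- j) b) = Y (- l) (- j) (sgn_ix (- l) * bar \<tau> * sgn_ix k * b)"
      by (rule comm_lift_E_E_mult) (simp_all add: pr)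
    also have "sgn_ix (- l) * bar \<tau> * sgn_ix k * b = - \<sigma>"
      by (simp add: \<tau>_def \<sigma>_def A_def bar_mult mult.assoc bar_sgn_mult)
    finally show ?thesis .
  qed
  have "comm_lift ?x (group_comm G ?y ?z) =
      Y (- l) (- j) (- \<sigma>) \<otimes>\<^bsub>H\<^esub> T j s \<otimes>\<^bsub>H\<^esub>
      (Y k (- j) \<tau> \<otimes>\<^bsub>H\<^esub> (Z (- l) j (twist \<zeta>) \<otimes>\<^bsub>H\<^esub> Y (- l) (- j) \<sigma>))"
    unfolding lift_yz_xyz[symmetric] lift_xy_yz[symmetric] lift_xyz[symmetric]
    by (rule comm_lift_witt) (simp_all add: pr ua comm_lift_S_E)
  also have "Y (- l) (- j) (- \<sigma>) \<otimes>\<^bsub>H\<^esub> T j s = T j s \<otimes>\<^bsub>H\<^esub> Y (- l) (- j) (- \<sigma>)"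
    by (rule commute_Y_T) (simp_all add: pr)
  also have "Z (- l) j (twist \<zeta>) \<otimes>\<^bsub>H\<^esub> Y (- l) (- j) \<sigma> = Y (- l) (- j) \<sigma> \<otimes>\<^bsub>H\<^esub> Z (- l) j (twist \<zeta>)"
    by (rule commute_Y_Z[symmetric]) (simp_all add: pr \<zeta>(2))
  also have "Y k (- j) \<tau> \<otimes>\<^bsub>H\<^esub> (Y (- l) (- j) \<sigma> \<otimes>\<^bsub>H\<^esub> Z (- l) j (twist \<zeta>)) =
      (Y k (- j) \<tau> \<otimes>\<^bsub>H\<^esub> Y (- l) (- j) \<sigma>) \<otimes>\<^bsub>H\<^esub> Z (- l) j (twist \<zeta>)"
    using pr \<zeta>(2) by (simp add: H.m_assoc)
  also have "Y k (- j) \<tau> \<otimes>\<^bsub>H\<^esub> Y (- l) (- j) \<sigma> = Y (- l) (- j) \<sigma> \<otimes>\<^bsub>H\<^esub> Y k (- j) \<tau>"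
    by (rule commute_Y_Y) (simp_all add: pr)
  also have "T j s \<otimes>\<^bsub>H\<^esub> Y (- l) (- j) (- \<sigma>) \<otimes>\<^bsub>H\<^esub>
      (Y (- l) (- j) \<sigma> \<otimes>\<^bsub>H\<^esub> Y k (- j) \<tau> \<otimes>\<^bsub>H\<^esub> Z (- l) j (twist \<zeta>)) =
      T j s \<otimes>\<^bsub>H\<^esub> (Y (- l) (- j) (- \<sigma>) \<otimes>\<^bsub>H\<^esub> Y (- l) (- j) \<sigma>) \<otimes>\<^bsub>H\<^esub> (Y k (- j) \<tau> \<otimes>\<^bsub>H\<^esub> Z (- l) j (twist \<zeta>))"
    using pr \<zeta>(2) by (simp add: H.m_assoc del: Y_add)
  also have "\<dots> = T j s \<otimes>\<^bsub>H\<^esub> (Y k (- j) \<tau> \<otimes>\<^bsub>H\<^esub> Z (- l) j (twist \<zeta>))"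
    using pr by (simp add: Y_add Y_zero)
  also have "Y k (- j) \<tau> \<otimes>\<^bsub>H\<^esub> Z (- l) j (twist \<zeta>) = Z (- l) j (twist \<zeta>) \<otimes>\<^bsub>H\<^esub> Y k (- j) \<tau>"
    by (rule commute_Y_Z) (simp_all add: pr \<zeta>(2))
  also have "T j s \<otimes>\<^bsub>H\<^esub> (Z (- l) j (twist \<zeta>) \<otimes>\<^bsub>H\<^esub> Y k (- j) \<tau>) =
      (Z (- l) j (0, s + bar s) \<otimes>\<^bsub>H\<^esub> Z (- l) j (twist \<zeta>)) \<otimes>\<^bsub>H\<^esub> Y k (- j) \<tau>"
    using pr \<zeta>(2) Z_min_eq_T[of "- l" j s] by (simp add: H.m_assoc)
  also have "Z (- l) j (0, s + bar s) \<otimes>\<^bsub>H\<^esub> Z (- l) j (twist \<zeta>) = Z (- l) j (heis_add B (0, s + bar s) (twist \<zeta>))"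
    by (rule Z_add[symmetric]) (simp_all add: pr \<zeta>(2))
  also have "heis_add B (0, s + bar s) (twist \<zeta>) = \<zeta>"
    by (simp add: \<zeta>(1) heis_add_def bar_A flip: bar_A)
  finally show ?thesis
    unfolding yz \<tau>_def \<zeta>_def .
qed

lemma Z_indep:
  assumes "root_pair n k j" "root_pair n k' j" "\<xi> \<in> L"
  shows "Z k j \<xi> = Z k' j \<xi>"
proof -
  have *: "Z k j \<xi> = Z l j \<xi>" if kl: "root_pair n k j" "root_pair n l j" "root_pair n k l" for k l
  proof -
    obtain u a where t: "twist \<xi> = (u, a)" by (cases "twist \<xi>")
    have ua: "(u, a) \<in> L" and \<xi>: "\<xi> = (u, - bar a)"
      using t twist_closed[OF assms(3)] twist_twist[of \<xi>] by simp_all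
    have "Z k j \<xi> \<otimes>\<^bsub>H\<^esub> Y k (- j) (sgn_ix k * a) = Z l j \<xi> \<otimes>\<^bsub>H\<^esub> Y k (- j) (sgn_ix k * a)"
      using comm_lift_S_E_opp_shift[of k j "- l" u a 1] comm_lift_S_E_one[OF kl(1) ua] ua kl by (simp add: \<xi>)
    then show ?thesis
      using kl assms(3) by simp
  qed
  show ?thesis
  proof (cases "\<bar>k\<bar> = \<bar>k'\<bar>")
    case False
    then show ?thesis
      using assms by (intro *) (auto simp: root_pair_def)
  next
    case True
    obtain l where l: "root_pair n k l" "root_pair n l j"
      using obtain_index[OF rank, of j k k] assms(1) by (metis root_pair_def)
    then have "root_pair n l k'"
      using assms(2) True by (simp add: root_pair_def)
    then show ?thesis
      using *[OF assms(1) l(2,1)] *[OF l(2) assms(2)] by simp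
  qed
qed

definition W :: "int \<Rightarrow> 'v \<times> 'r \<Rightarrow> 'h" where
  "W j = Z (off j j) j"

lemma W_eq: "root_pair n k j \<Longrightarrow> \<xi> \<in> L \<Longrightarrow> W j \<xi> = Z k j \<xi>"
  using Z_indep[of "off j j" j k \<xi>] root_pair_off[of j j] root_pairD(3)[of n k j] by (simp add: W_def)

lemma W_closed: "j \<in> index_set n \<Longrightarrow> \<xi> \<in> L \<Longrightarrow> W j \<xi> \<in> carrier H"
  and ext_W: "j \<in> index_set n \<Longrightarrow> \<xi> \<in> L \<Longrightarrow> \<epsilon> (W j \<xi>) = S j \<xi>"
  and W_add: "j \<in> index_set n \<Longrightarrow> \<xi> \<in> L \<Longrightarrow> \<zeta> \<in> L \<Longrightarrow> W j \<xi> \<otimes>\<^bsub>H\<^esub> W j \<zeta> = W j (heis_add B \<xi> \<zeta>)"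
  using root_pair_off[of j j] by (simp_all add: W_def Z_add)

lemma W_min: "j \<in> index_set n \<Longrightarrow> W j (0, s + bar s) = T j s"
  using root_pair_off[of j j] by (simp add: W_def Z_min_eq_T)

text \<open>
  Additivity alone forces this: \<open>(0, B u v - B v u)\<close> is the commutator of \<open>(u, a)\<close> and \<open>(v, b)\<close> in
  the Heisenberg group.
\<close>

lemma comm_W_W:
  assumes j: "j \<in> index_set n" and ua: "(u, a) \<in> L" and vb: "(v, b) \<in> L"
  shows "group_comm H (W j (u, a)) (W j (v, b)) = W j (0, B u v - B v u)"
proof -
  let ?c = "(0, B u v - B v u)"
  have c: "?c \<in> L" by (rule L_R7)
  have "heis_add B ?c (heis_add B (v, b) (u, a)) = heis_add B (u, a) (v, b)"
    by (simp add: heis_add_def add.commute)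
  then have *: "W j ?c \<otimes>\<^bsub>H\<^esub> (W j (v, b) \<otimes>\<^bsub>H\<^esub> W j (u, a)) = W j (u, a) \<otimes>\<^bsub>H\<^esub> W j (v, b)"
    using j ua vb c by (simp add: W_add)
  show ?thesis
    unfolding group_comm_def *[symmetric]
    using j ua vb c by (simp add: H.m_assoc W_closed)
qed

theorem steinberg_family_lift: "steinberg_family bar act B L H n Y W"
proof unfold_locales
  fix i j k h :: int and a b :: 'r and u v :: 'v and \<xi> \<zeta> :: "'v \<times> 'r"
  show "group_comm H (Y i j a) (Y h k b) = \<one>\<^bsub>H\<^esub>"
    if "root_pair n i j" "root_pair n h k" "h \<notin> {j, - i}" "k \<notin> {i, - j}"
    using that by (simp add: group_comm_eq_comm_lift comm_lift_E_E)
  show "group_comm H (W i \<xi>) (Y j k a) = \<one>\<^bsub>H\<^esub>"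
    if "i \<in> index_set n" "\<xi> \<in> L" "root_pair n j k" "j \<noteq> - i" "k \<noteq> i"
    using that by (simp add: group_comm_eq_comm_lift W_closed ext_W comm_lift_S_E)
  show "group_comm H (Y i j a) (Y j k b) = Y i k (a * b)"
    if "root_pair n i j" "root_pair n j k" "root_pair n i k"
    using that by (simp add: group_comm_eq_comm_lift comm_lift_E_E_mult)
  show "group_comm H (W i (u, a)) (W j (v, b)) = Y i (- j) (sgn_ix i * B u v)"
    if "root_pair n i j" "(u, a) \<in> L" "(v, b) \<in> L"
    using that root_pairD(2,3)[OF that(1)]
    by (simp add: group_comm_eq_comm_lift W_closed ext_W comm_lift_S_S)
  show "group_comm H (W i (u, a)) (W i (v, b)) = W i (0, B u v - B v u)"
    if "i \<in> index_set n" "(u, a) \<in> L" "(v, b) \<in> L"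
    using that by (rule comm_W_W)
  show "group_comm H (W i (u, a)) (Y (- i) j b) =
      Y i j (sgn_ix i * a * b) \<otimes>\<^bsub>H\<^esub> W (- j) (heis_act bar act (u, - bar a) b)"
    if ij: "root_pair n i j" and ua: "(u, a) \<in> L"
  proof -
    obtain l where l: "root_pair n i l" "root_pair n l j"
      using obtain_index[OF rank, of j i i] ij by (metis root_pair_def)
    have "group_comm H (W i (u, a)) (Y (- i) j b) = comm_lift (S i (u, a)) (E (- i) j b)"
      using ij ua root_pairD(2)[OF ij] by (simp add: group_comm_eq_comm_lift W_closed ext_W)
    also have "\<dots> = Z l (- j) (heis_act bar act (u, - bar a) b) \<otimes>\<^bsub>H\<^esub> Y i j (sgn_ix i * a * b)"
      using comm_lift_S_E_opp_shift[of i "- j" "- l" u a b] l ij ua by simp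
    also have "\<dots> = Y i j (sgn_ix i * a * b) \<otimes>\<^bsub>H\<^esub> Z l (- j) (heis_act bar act (u, - bar a) b)"
      by (rule commute_Y_Z[symmetric])
        (simp_all add: ij l ua root_pair_neq root_pair_sym root_pairD(3)[OF ij])
    finally show ?thesis
      using W_eq[of l "- j" "heis_act bar act (u, - bar a) b"] l ua by simp
  qed
  show "group_comm H (Y i j a) (Y j (- i) b) =
      W i (0, - sgn_ix (- i) * e * a * b + bar b * e_inv * bar a * sgn_ix i)"
    if "root_pair n i j"
    unfolding R9_parameter[OF root_pairD(4)[OF that]] W_min[OF root_pairD(2)[OF that]]
    using that by (simp add: group_comm_eq_comm_lift comm_lift_E_E_opp root_pair_sym)
qed (simp_all add: W_closed W_add Y_add Y_minus[symmetric])

end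

section \<open>Homomorphisms from presented groups\<close>

context group
begin

definition eval_word :: "('x \<Rightarrow> 'a) \<Rightarrow> 'x word \<Rightarrow> 'a" where
  "eval_word f w = foldr (\<lambda>(b, x) g. (if b then f x else inv f x) \<otimes> g) w \<one>"

lemma eval_word_Nil [simp]: "eval_word f [] = \<one>"
  and eval_word_Cons [simp]:
    "eval_word f ((b, x) # w) = (if b then f x else inv f x) \<otimes> eval_word f w"
  by (simp_all add: eval_word_def)

lemma eval_word_closed [simp]: "f \<in> S \<rightarrow> carrier G \<Longrightarrow> w \<in> words S \<Longrightarrow> eval_word f w \<in> carrier G"
  by (induction w) (auto simp: Pi_iff)

lemma eval_word_append:
  "f \<in> S \<rightarrow> carrier G \<Longrightarrow> u \<in> words S \<Longrightarrow> v \<in> words S \<Longrightarrow>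
    eval_word f (u @ v) = eval_word f u \<otimes> eval_word f v"
proof (induction u)
  case (Cons l u)
  then show ?case
    by (cases l) (auto simp: m_assoc Pi_iff)
qed simp

lemma eval_word_inv:
  "f \<in> S \<rightarrow> carrier G \<Longrightarrow> w \<in> words S \<Longrightarrow> eval_word f (word_inv w) = inv eval_word f w"
proof (induction w)
  case Nil
  then show ?case by (simp add: word_inv_def)
next
  case (Cons l w)
  obtain b x where l: "l = (b, x)" by (cases l)
  with Cons.prems have x: "x \<in> S" "w \<in> words S" "f x \<in> carrier G" by auto
  have "word_inv (l # w) = word_inv w @ [(\<not> b, x)]"
    by (simp add: word_inv_def l)
  then show ?case
    using Cons.IH Cons.prems(1) x by (simp add: l eval_word_append inv_mult_group)
qed

lemma eval_word_comm:
  "f \<in> S \<rightarrow> carrier G \<Longrightarrow> u \<in> words S \<Longrightarrow> v \<in> words S \<Longrightarrow>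
    eval_word f (word_comm u v) = group_comm G (eval_word f u) (eval_word f v)"
  by (simp add: word_comm_def group_comm_def eval_word_append eval_word_inv m_assoc)

lemma eval_word_pres_eq:
  assumes f: "f \<in> S \<rightarrow> carrier G"
    and R: "\<And>u v. (u, v) \<in> R \<Longrightarrow> u \<in> words S \<Longrightarrow> v \<in> words S \<Longrightarrow> eval_word f u = eval_word f v"
    and "pres_eq S R u v"
  shows "eval_word f u = eval_word f v"
  using assms(3)
proof (induction rule: pres_eq.induct)
  case (append u v u' v')
  then show ?case
    using pres_eq_words[OF append(1)] pres_eq_words[OF append(2)] by (simp add: eval_word_append[OF f])
next
  case (cancel x b)
  then have "f x \<in> carrier G"
    using f by blast
  then show ?case
    by (cases b) simp_all
qed (auto intro: R)

lemma presented_group_hom: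
  assumes f: "f \<in> S \<rightarrow> carrier G"
    and R: "\<And>u v. (u, v) \<in> R \<Longrightarrow> u \<in> words S \<Longrightarrow> v \<in> words S \<Longrightarrow> eval_word f u = eval_word f v"
  obtains \<phi> where "\<phi> \<in> hom (presented_group S R) G"
    "\<And>x. x \<in> S \<Longrightarrow> \<phi> (word_class S R [(True, x)]) = f x"
proof -
  define \<phi> where "\<phi> A = eval_word f (SOME w. w \<in> words S \<and> word_class S R w = A)" for A
  have \<phi>: "\<phi> (word_class S R w) = eval_word f w" if w: "w \<in> words S" for w
  proof -
    let ?w = "SOME v. v \<in> words S \<and> word_class S R v = word_class S R w"
    have "?w \<in> words S \<and> word_class S R ?w = word_class S R w"
      by (rule someI[of "\<lambda>v. v \<in> words S \<and> word_class S R v = word_class S R w" w]) (simp add: w)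
    then have eq: "pres_eq S R ?w w"
      using word_class_eq_iff[of ?w S R w] by blast
    show ?thesis
      unfolding \<phi>_def by (rule eval_word_pres_eq[OF f R eq])
  qed
  have "\<phi> \<in> hom (presented_group S R) G"
  proof (rule homI)
    have C: "carrier (presented_group S R) = word_class S R ` words S"
      by (simp add: presented_group_def)
    show "\<phi> A \<in> carrier G" if "A \<in> carrier (presented_group S R)" for A
      using that f by (auto simp: C \<phi>)
    show "\<phi> (A \<otimes>\<^bsub>presented_group S R\<^esub> A') = \<phi> A \<otimes> \<phi> A'"
      if "A \<in> carrier (presented_group S R)" "A' \<in> carrier (presented_group S R)" for A A'
      using that f by (auto simp: C \<phi> presented_group_mult eval_word_append)
  qed
  moreover have "\<phi> (word_class S R [(True, x)]) = f x" if "x \<in> S" for x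
    using that funcset_mem[OF f that] by (simp add: \<phi>)
  ultimately show thesis
    by (rule that)
qed

end

lemma word_class_closed [simp]: "w \<in> words S \<Longrightarrow> word_class S R w \<in> carrier (presented_group S R)"
  by (simp add: presented_group_def)

lemma word_class_relation:
  "(u, v) \<in> R \<Longrightarrow> u \<in> words S \<Longrightarrow> v \<in> words S \<Longrightarrow> word_class S R u = word_class S R v"
  using word_class_eq_iff[of u S R v] pres_eq.relation[of u v R S] by simp

lemma inv_word_class:
  assumes "w \<in> words S"
  shows "inv\<^bsub>presented_group S R\<^esub> word_class S R w = word_class S R (word_inv w)"
proof (rule group.inv_equality[OF group_presented_group])
  have "word_class S R (word_inv w @ w) = word_class S R []"
    using assms pres_eq_inv_left[OF assms, of R] by (simp add: word_class_eq_iff)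
  then show "word_class S R (word_inv w) \<otimes>\<^bsub>presented_group S R\<^esub> word_class S R w =
      \<one>\<^bsub>presented_group S R\<^esub>"
    using assms by (simp add: presented_group_mult) (simp add: presented_group_def)
qed (use assms in simp_all)

lemma word_class_comm:
  "u \<in> words S \<Longrightarrow> v \<in> words S \<Longrightarrow>
    word_class S R (word_comm u v) = group_comm (presented_group S R) (word_class S R u) (word_class S R v)"
  by (simp add: word_comm_def group_comm_def inv_word_class presented_group_mult)

lemma presented_group_hom_eqI:
  assumes K: "group K" and \<phi>: "\<phi> \<in> hom (presented_group S R) K" and \<psi>: "\<psi> \<in> hom (presented_group S R) K"
    and eq: "\<And>x. x \<in> S \<Longrightarrow> \<phi> (word_class S R [(True, x)]) = \<psi> (word_class S R [(True, x)])"
    and A: "A \<in> carrier (presented_group S R)"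
  shows "\<phi> A = \<psi> A"
proof -
  let ?P = "presented_group S R"
  interpret P: group ?P by (rule group_presented_group)
  interpret K: group K by (rule K)
  interpret \<phi>: group_hom ?P K \<phi> by unfold_locales (rule \<phi>)
  interpret \<psi>: group_hom ?P K \<psi> by unfold_locales (rule \<psi>)
  have letter: "\<phi> (word_class S R [(b, x)]) = \<psi> (word_class S R [(b, x)])" if x: "x \<in> S" for b x
  proof (cases b)
    case False
    have "word_class S R [(False, x)] = inv\<^bsub>?P\<^esub> word_class S R [(True, x)]"
      using x by (subst inv_word_class) (simp_all add: word_inv_def)
    with False x eq[OF x] show ?thesis by simp
  qed (use eq x in simp)
  have "\<phi> (word_class S R w) = \<psi> (word_class S R w)" if "w \<in> words S" for w
    using that
  proof (induction w)
    case Nil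
    have "word_class S R [] = \<one>\<^bsub>?P\<^esub>" by (simp add: presented_group_def)
    then show ?case by simp
  next
    case (Cons l w)
    obtain b x where l: "l = (b, x)" by (cases l)
    with Cons.prems have x: "x \<in> S" "w \<in> words S" by auto
    have "word_class S R (l # w) = word_class S R [(b, x)] \<otimes>\<^bsub>?P\<^esub> word_class S R w"
      using x by (simp add: l presented_group_mult)
    then show ?case
      using x Cons.IH letter[OF x(1)] by simp
  qed
  moreover obtain w where "w \<in> words S" "A = word_class S R w"
    using A by (auto simp: presented_group_def)
  ultimately show ?thesis by simp
qed

section \<open>The odd unitary Steinberg group\<close>

lemma Gen2_in_stu_gens [simp]: "Gen2 i j a \<in> stu_gens n L \<longleftrightarrow> root_pair n i j"
  by (auto simp: stu_gens_def root_pair_def abs_eq_iff)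

lemma Gen1_in_stu_gens [simp]: "Gen1 i \<xi> \<in> stu_gens n L \<longleftrightarrow> i \<in> index_set n \<and> \<xi> \<in> L"
  by (cases \<xi>) (auto simp: stu_gens_def)

lemma word_comm_in_words [simp]: "word_comm u v \<in> words S \<longleftrightarrow> u \<in> words S \<and> v \<in> words S"
  by (auto simp: word_comm_def)

context quadratic_space
begin

abbreviation StU_S :: "nat \<Rightarrow> int \<Rightarrow> 'v \<times> 'r \<Rightarrow> ('r, 'v) stu_gen word set" where
  "StU_S n i \<xi> \<equiv> word_class (stu_gens n L) (stu_rels bar act B) (X1 i \<xi>)"

lemma steinberg_family_StU:
  "steinberg_family bar act B L (StU bar act B L n) n (StU_X bar act B L n) (StU_S n)"
proof -
  let ?S = "stu_gens n L" and ?R = "stu_rels bar act B"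
  interpret P: group "presented_group ?S ?R"
    by (rule group_presented_group)
  note rel = word_class_relation[where S = ?S and R = ?R]
  have one: "\<one>\<^bsub>presented_group ?S ?R\<^esub> = word_class ?S ?R []"
    by (simp add: presented_group_def)
  show ?thesis
    unfolding StU_def StU_X_def
  proof unfold_locales
    fix i j k h :: int and a b :: 'r and u v :: 'v and \<xi> \<zeta> :: "'v \<times> 'r"
    show "word_class ?S ?R (X2 i j a) =
        word_class ?S ?R (X2 (- j) (- i) (sgn_ix (- j) * bar a * sgn_ix i))" if "root_pair n i j"
      using that by (intro rel stu_rels.R0) (simp_all add: root_pair_sym)
    show "word_class ?S ?R (X2 i j a) \<otimes>\<^bsub>presented_group ?S ?R\<^esub> word_class ?S ?R (X2 i j b) =
        word_class ?S ?R (X2 i j (a + b))" if "root_pair n i j"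
      using that rel[OF stu_rels.R1[of i j a b]] by (simp add: presented_group_mult)
    show "StU_S n i \<xi> \<otimes>\<^bsub>presented_group ?S ?R\<^esub> StU_S n i \<zeta> = StU_S n i (heis_add B \<xi> \<zeta>)"
      if "i \<in> index_set n" "\<xi> \<in> L" "\<zeta> \<in> L"
      using that rel[OF stu_rels.R2[of i \<xi> \<zeta>]] by (simp add: presented_group_mult)
    show "group_comm (presented_group ?S ?R) (word_class ?S ?R (X2 i j a)) (word_class ?S ?R (X2 h k b)) =
        \<one>\<^bsub>presented_group ?S ?R\<^esub>"
      if "root_pair n i j" "root_pair n h k" "h \<notin> {j, - i}" "k \<notin> {i, - j}"
      using that rel[OF stu_rels.R3[OF that(3,4), where a = a and b = b]] by (simp add: word_class_comm one)
    show "group_comm (presented_group ?S ?R) (StU_S n i \<xi>) (word_class ?S ?R (X2 j k a)) =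
        \<one>\<^bsub>presented_group ?S ?R\<^esub>"
      if "i \<in> index_set n" "\<xi> \<in> L" "root_pair n j k" "j \<noteq> - i" "k \<noteq> i"
      using that rel[OF stu_rels.R4[OF that(4,5), where \<xi> = \<xi> and a = a]] by (simp add: word_class_comm one)
    show "group_comm (presented_group ?S ?R) (word_class ?S ?R (X2 i j a)) (word_class ?S ?R (X2 j k b)) =
        word_class ?S ?R (X2 i k (a * b))"
      if "root_pair n i j" "root_pair n j k" "root_pair n i k"
      using that rel[OF stu_rels.R5[of i j a k b]] by (simp add: word_class_comm)
    show "group_comm (presented_group ?S ?R) (StU_S n i (u, a)) (StU_S n j (v, b)) =
        word_class ?S ?R (X2 i (- j) (sgn_ix i * B u v))"
      if "root_pair n i j" "(u, a) \<in> L" "(v, b) \<in> L"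
      using that rel[OF stu_rels.R6[where i = i and j = j and u = u and a = a and v = v and b = b]] root_pairD[OF that(1)] by (simp add: word_class_comm)
    show "group_comm (presented_group ?S ?R) (StU_S n i (u, a)) (StU_S n i (v, b)) =
        StU_S n i (0, B u v - B v u)"
      if "i \<in> index_set n" "(u, a) \<in> L" "(v, b) \<in> L"
      using that rel[OF stu_rels.R7[of i u a v b]] L_R7 by (simp add: word_class_comm)
    show "group_comm (presented_group ?S ?R) (StU_S n i (u, a)) (word_class ?S ?R (X2 (- i) j b)) =
        word_class ?S ?R (X2 i j (sgn_ix i * a * b)) \<otimes>\<^bsub>presented_group ?S ?R\<^esub>
        StU_S n (- j) (heis_act bar act (u, - bar a) b)"
      if "root_pair n i j" "(u, a) \<in> L"
      using that rel[OF stu_rels.R8[of i u a j b]] root_pairD(2,3)[OF that(1)]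
      by (simp add: word_class_comm presented_group_mult)
    show "group_comm (presented_group ?S ?R) (word_class ?S ?R (X2 i j a)) (word_class ?S ?R (X2 j (- i) b)) =
        StU_S n i (0, - sgn_ix (- i) * e * a * b + bar b * e_inv * bar a * sgn_ix i)"
      if "root_pair n i j"
    proof -
      have "(0, - sgn_ix (- i) * e * a * b + bar b * e_inv * bar a * sgn_ix i) \<in> L"
        unfolding R9_parameter[OF root_pairD(4)[OF that]] by (rule L_min)
      then show ?thesis
        using that rel[OF stu_rels.R9[of i j a b]] root_pairD[OF that]
        by (simp add: word_class_comm)
    qed
  qed simp_all
qed

lemma StU_hom_of_steinberg_family:
  assumes "steinberg_family bar act B L K n Y W"
  obtains \<phi> where "\<phi> \<in> hom (StU bar act B L n) K"
    "\<And>i j a. root_pair n i j \<Longrightarrow> \<phi> (StU_X bar act B L n i j a) = Y i j a"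
    "\<And>i \<xi>. i \<in> index_set n \<Longrightarrow> \<xi> \<in> L \<Longrightarrow> \<phi> (StU_S n i \<xi>) = W i \<xi>"
proof -
  interpret K: steinberg_family bar act B L K n Y W by (rule assms)
  let ?S = "stu_gens n L" and ?R = "stu_rels bar act B"
  define f where "f = case_stu_gen Y W"
  have f: "f \<in> ?S \<rightarrow> carrier K"
    by (auto simp: f_def stu_gens_def root_pair_def abs_eq_iff)
  have f_simps [simp]: "f (Gen2 i j a) = Y i j a" "f (Gen1 i \<xi>) = W i \<xi>" for i j a \<xi>
    by (simp_all add: f_def)
  note ev = K.eval_word_comm[OF f]
  have "K.eval_word f u = K.eval_word f v" if "(u, v) \<in> ?R" "u \<in> words ?S" "v \<in> words ?S" for u v
    using that
  proof (induction rule: stu_rels.induct)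
    case (R0 i j a)
    then show ?case using K.E_minus[of i j a] by (simp add: root_pair_sym)
  next
    case (R1 i j a b)
    then show ?case by (simp add: K.E_add K.m_assoc[symmetric])
  next
    case (R2 i \<xi> \<zeta>)
    then show ?case by (simp add: K.S_add K.m_assoc[symmetric])
  next
    case (R3 h j i k a b)
    then show ?case by (simp add: ev K.comm_E_E)
  next
    case (R4 j i k \<xi> a)
    then show ?case by (simp add: ev K.comm_S_E)
  next
    case (R5 i j a k b)
    then show ?case by (simp add: ev K.comm_E_E_mult)
  next
    case (R6 i j u a v b)
    then show ?case using K.comm_S_S[of i j u a v b] by (simp add: ev)
  next
    case (R7 i u a v b)
    then show ?case using K.comm_S_S_same[of i u a v b] by (simp add: ev)
  next
    case (R8 i u a j b)
    then show ?case using K.comm_S_E_opp[of i j u a b] by (simp add: ev)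
  next
    case (R9 i j a b)
    then show ?case using K.comm_E_E_short[of i j a b] by (simp add: ev)
  qed
  from K.presented_group_hom[OF f this] obtain \<phi> where
    "\<phi> \<in> hom (presented_group ?S ?R) K" "\<And>x. x \<in> ?S \<Longrightarrow> \<phi> (word_class ?S ?R [(True, x)]) = f x"
    by metis
  then show thesis
    by (intro that[of \<phi>]) (simp_all add: StU_def StU_X_def)
qed

end

section \<open>The Schur multiplier\<close>

lemma card_indices_eq_8D:
  fixes i j k h :: int
  assumes "card {i, - i, j, - j, k, - k, h, - h} = 8"
  shows "\<bar>i\<bar> \<noteq> \<bar>j\<bar>" "\<bar>i\<bar> \<noteq> \<bar>k\<bar>" "\<bar>i\<bar> \<noteq> \<bar>h\<bar>" "\<bar>j\<bar> \<noteq> \<bar>k\<bar>" "\<bar>j\<bar> \<noteq> \<bar>h\<bar>" "\<bar>k\<bar> \<noteq> \<bar>h\<bar>"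
proof -
  have six: "card {a, - a, b, - b, c, - c} < 8" for a b c :: int
    using card_length[of "[a, - a, b, - b, c, - c]"] by simp
  have sub: False if "{i, - i, j, - j, k, - k, h, - h} \<subseteq> {a, - a, b, - b, c, - c}" for a b c
    using card_mono[OF _ that] six[of a b c] assms by simp
  show "\<bar>i\<bar> \<noteq> \<bar>j\<bar>" using sub[of j k h] by (auto simp: abs_eq_iff)
  show "\<bar>i\<bar> \<noteq> \<bar>k\<bar>" using sub[of j k h] by (auto simp: abs_eq_iff)
  show "\<bar>i\<bar> \<noteq> \<bar>h\<bar>" using sub[of j k h] by (auto simp: abs_eq_iff)
  show "\<bar>j\<bar> \<noteq> \<bar>k\<bar>" using sub[of i k h] by (auto simp: abs_eq_iff)
  show "\<bar>j\<bar> \<noteq> \<bar>h\<bar>" using sub[of i k h] by (auto simp: abs_eq_iff)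
  show "\<bar>k\<bar> \<noteq> \<bar>h\<bar>" using sub[of i j h] by (auto simp: abs_eq_iff)
qed

lemma card_indices_eq_8I:
  fixes i j k h :: int
  assumes "\<bar>i\<bar> \<noteq> \<bar>j\<bar>" "\<bar>i\<bar> \<noteq> \<bar>k\<bar>" "\<bar>i\<bar> \<noteq> \<bar>h\<bar>" "\<bar>j\<bar> \<noteq> \<bar>k\<bar>" "\<bar>j\<bar> \<noteq> \<bar>h\<bar>" "\<bar>k\<bar> \<noteq> \<bar>h\<bar>"
    and "i \<noteq> 0" "j \<noteq> 0" "k \<noteq> 0" "h \<noteq> 0"
  shows "card {i, - i, j, - j, k, - k, h, - h} = 8"
proof -
  have ne: "x \<noteq> y \<and> x \<noteq> - y \<and> - x \<noteq> y" if "\<bar>x\<bar> \<noteq> \<bar>y\<bar>" for x y :: int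
    using that by auto
  have "distinct [i, - i, j, - j, k, - k, h, - h]"
    by (simp add: assms(7-10) ne[OF assms(1)] ne[OF assms(2)] ne[OF assms(3)] ne[OF assms(4)]
        ne[OF assms(5)] ne[OF assms(6)])
  from distinct_card[OF this] show ?thesis by simp
qed

lemma (in group) central_subgroup_normal:
  assumes "subgroup N G" "N \<subseteq> group_center G"
  shows "N \<lhd> G"
proof (rule normal_invI[OF assms(1)])
  fix x h assume *: "x \<in> carrier G" "h \<in> N"
  then have "h \<otimes> x = x \<otimes> h" "h \<in> carrier G"
    using assms(2) by (auto simp: group_center_def)
  then have "x \<otimes> h \<otimes> inv x = h"
    using * by (intro commute_conj) simp_all
  then show "x \<otimes> h \<otimes> inv x \<in> N"
    using * by simp
qed

lemma central_extension_quotient: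
  assumes ext: "central_extension U G \<pi>" and N: "subgroup N U" "N \<subseteq> kernel U G \<pi>"
  obtains \<epsilon> where "central_extension (U Mod N) G \<epsilon>"
    "\<And>x. x \<in> carrier U \<Longrightarrow> \<epsilon> (N #>\<^bsub>U\<^esub> x) = \<pi> x"
    "N \<lhd> U"
proof -
  interpret central_ext U G \<pi> by unfold_locales (rule ext)
  have center: "kernel U G \<pi> \<subseteq> group_center U"
    using ext by (simp add: central_extension_def)
  have normal: "N \<lhd> U"
    using H.central_subgroup_normal N center by blast
  interpret N: normal N U by (rule normal)
  define \<epsilon> where "\<epsilon> A = the_elem (\<pi> ` A)" for A
  have \<epsilon>: "\<epsilon> (N #>\<^bsub>U\<^esub> x) = \<pi> x" if x: "x \<in> carrier U" for x
  proof -
    have "\<pi> y = \<pi> x" if y: "y \<in> N #>\<^bsub>U\<^esub> x" for y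
    proof -
      obtain h where h: "h \<in> N" "y = h \<otimes>\<^bsub>U\<^esub> x"
        using y unfolding r_coset_def by blast
      have "h \<in> kernel U G \<pi>"
        using h(1) N(2) by blast
      then have "h \<in> carrier U" "\<pi> h = \<one>\<^bsub>G\<^esub>"
        by (simp_all add: kernel_def)
      then show ?thesis
        using x by (simp add: h(2))
    qed
    moreover have "x \<in> N #>\<^bsub>U\<^esub> x"
      using x by (rule H.rcos_self[OF _ N(1)])
    ultimately have "\<pi> ` (N #>\<^bsub>U\<^esub> x) = {\<pi> x}"
      by blast
    then show ?thesis by (simp add: \<epsilon>_def)
  qed
  have C: "carrier (U Mod N) = (\<lambda>x. N #>\<^bsub>U\<^esub> x) ` carrier U"
    by (auto simp: FactGroup_def RCOSETS_def)
  have "\<epsilon> \<in> hom (U Mod N) G"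
    by (rule homI) (auto simp: C N.rcos_sum \<epsilon>)
  moreover have "\<epsilon> ` carrier (U Mod N) = carrier G"
  proof -
    have "\<epsilon> ` carrier (U Mod N) = \<pi> ` carrier U"
      unfolding C image_image by (rule image_cong) (simp_all add: \<epsilon>)
    then show ?thesis
      using ext by (simp add: central_extension_def epi_def)
  qed
  moreover have "kernel (U Mod N) G \<epsilon> \<subseteq> group_center (U Mod N)"
  proof
    fix A assume "A \<in> kernel (U Mod N) G \<epsilon>"
    then obtain x where x: "x \<in> carrier U" "A = N #>\<^bsub>U\<^esub> x" "\<pi> x = \<one>\<^bsub>G\<^esub>"
      by (auto simp: kernel_def C \<epsilon>)
    then show "A \<in> group_center (U Mod N)"
      using kernel_commutes[OF x(1,3)] by (auto simp: group_center_def C N.rcos_sum)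
  qed
  ultimately have "central_extension (U Mod N) G \<epsilon>"
    using N.factorgroup_is_group G.group_axioms by (simp add: central_extension_def epi_def)
  then show thesis
    using \<epsilon> normal that by blast
qed

theorem theorem2:
  fixes bar :: "'r::{ring,monoid_mult} \<Rightarrow> 'r"
    and act :: "'v::ab_group_add \<Rightarrow> 'r \<Rightarrow> 'v"
    and B :: "'v \<Rightarrow> 'v \<Rightarrow> 'r"
    and L :: "('v \<times> 'r) set"
    and U :: "'u monoid"
    and \<pi> :: "'u \<Rightarrow> ('r, 'v) stu_gen word set"
  assumes "pseudo_involution bar"
    and "odd_quadratic_space bar act B L"
    and "universal_central_extension U (StU bar act B L 4) \<pi>"
  shows "kernel U (StU bar act B L 4) \<pi> =
    generate U {group_comm U x y | x y i j k h a b.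
      i \<in> index_set 4 \<and> j \<in> index_set 4 \<and> k \<in> index_set 4 \<and> h \<in> index_set 4 \<and>
      card {i, - i, j, - j, k, - k, h, - h} = 8 \<and>
      x \<in> carrier U \<and> \<pi> x = StU_X bar act B L 4 i j a \<and>
      y \<in> carrier U \<and> \<pi> y = StU_X bar act B L 4 k h b}"
    (is "?K = generate U ?C")
proof -
  interpret quadratic_space bar act B L
    using assms(1,2) by unfold_locales
  let ?G = "StU bar act B L 4" and ?E = "StU_X bar act B L 4"
  define C where "C = ?C"
  let ?N = "generate U C"
  interpret F: steinberg_family bar act B L ?G 4 ?E "StU_S 4"
    by (rule steinberg_family_StU)
  have ext: "central_extension U ?G \<pi>"
    using assms(3) by (simp add: universal_central_extension_def)
  interpret U: central_ext U ?G \<pi>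
    by unfold_locales (rule ext)
  have ker: "subgroup ?K U"
    using group_hom.subgroup_kernel[of U ?G \<pi>] U.ext_hom
    by (simp add: group_hom_def group_hom_axioms_def U.H.group_axioms F.group_axioms)
  have "C \<subseteq> ?K"
    unfolding C_def
  proof clarify
    fix x y i j k h a b
    assume ix: "i \<in> index_set 4" "j \<in> index_set 4" "k \<in> index_set 4" "h \<in> index_set 4"
      and card: "card {i, - i, j, - j, k, - k, h, - h} = 8"
      and x: "x \<in> carrier U" "\<pi> x = ?E i j a" and y: "y \<in> carrier U" "\<pi> y = ?E k h b"
    note ne = card_indices_eq_8D[OF card]
    have "group_comm ?G (?E i j a) (?E k h b) = \<one>\<^bsub>?G\<^esub>"
      using ix ne by (intro F.comm_E_E) (auto simp: root_pair_def)
    then show "group_comm U x y \<in> ?K"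
      using x y by (simp add: kernel_def)
  qed
  then have sub: "?N \<subseteq> ?K"
    using ker by (intro U.H.generate_subgroup_incl)
  have CU: "C \<subseteq> carrier U"
    unfolding C_def by auto
  have N: "subgroup ?N U"
    by (rule U.H.generate_is_subgroup[OF CU])
  obtain \<epsilon> where \<epsilon>: "central_extension (U Mod ?N) ?G \<epsilon>"
    "\<And>x. x \<in> carrier U \<Longrightarrow> \<epsilon> (?N #>\<^bsub>U\<^esub> x) = \<pi> x" "?N \<lhd> U"
    by (rule central_extension_quotient[OF ext N sub]) (rule that; assumption)
  interpret N: normal ?N U by (rule \<epsilon>(3))
  let ?q = "\<lambda>x. ?N #>\<^bsub>U\<^esub> x"
  have q: "?q \<in> hom U (U Mod ?N)"
    by (rule N.r_coset_hom_Mod)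
  interpret Q: central_ext "U Mod ?N" ?G \<epsilon>
    by unfold_locales (rule \<epsilon>(1))
  interpret q: group_hom U "U Mod ?N" ?q
    by unfold_locales (rule q)
  have "Q.comm_lift (?E i j a) (?E k h b) = \<one>\<^bsub>U Mod ?N\<^esub>"
    if rp: "root_pair 4 i j" "root_pair 4 i k" "root_pair 4 i h" "root_pair 4 j k" "root_pair 4 j h" "root_pair 4 k h"
    for i j k h a b
  proof -
    obtain x where x: "x \<in> carrier U" "\<pi> x = ?E i j a"
      using U.obtain_preimage[OF F.E_closed[OF rp(1)]] by metis
    obtain y where y: "y \<in> carrier U" "\<pi> y = ?E k h b"
      using U.obtain_preimage[OF F.E_closed[OF rp(6)]] by metis
    have "card {i, - i, j, - j, k, - k, h, - h} = 8"
      using rp by (intro card_indices_eq_8I) (auto simp: root_pair_def index_set_def)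
    then have "group_comm U x y \<in> C"
      unfolding C_def using x y rp root_pairD(2,3)[OF rp(1)] root_pairD(2,3)[OF rp(6)] by blast
    then have "?q (group_comm U x y) = ?N"
      using N.rcos_const[OF U.H.group_axioms] generate.incl[of _ C U] by blast
    moreover have "?q (group_comm U x y) = group_comm (U Mod ?N) (?q x) (?q y)"
      using x y by (simp add: group_comm_def)
    moreover have "\<dots> = Q.comm_lift (?E i j a) (?E k h b)"
      using x y \<epsilon>(2) by (simp add: Q.group_comm_eq_comm_lift)
    ultimately show ?thesis
      by (simp add: FactGroup_def)
  qed
  \<comment> \<open>The commutators that generate \<open>N\<close> die in the quotient, which is the hypothesis on the
    extension.\<close>
  then interpret steinberg_lift bar act B L ?G 4 ?E "StU_S 4" "U Mod ?N" \<epsilon>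
    by unfold_locales simp_all
  obtain \<phi> where \<phi>: "\<phi> \<in> hom ?G (U Mod ?N)"
    "\<And>i j a. root_pair 4 i j \<Longrightarrow> \<phi> (?E i j a) = Y i j a"
    "\<And>i \<xi>. i \<in> index_set 4 \<Longrightarrow> \<xi> \<in> L \<Longrightarrow> \<phi> (StU_S 4 i \<xi>) = W i \<xi>"
    by (rule StU_hom_of_steinberg_family[OF steinberg_family_lift]) (rule that; assumption)
  have retract: "\<epsilon> (\<phi> g) = g" if g: "g \<in> carrier ?G" for g
  proof -
    have "(\<epsilon> \<circ> \<phi>) g = id g"
    proof (rule presented_group_hom_eqI[where K = ?G and \<phi> = "\<epsilon> \<circ> \<phi>" and \<psi> = id
          and S = "stu_gens 4 L" and R = "stu_rels bar act B"])
      show "group ?G"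
        by (rule F.group_axioms)
      show "\<epsilon> \<circ> \<phi> \<in> hom (presented_group (stu_gens 4 L) (stu_rels bar act B)) ?G"
        using hom_compose[OF \<phi>(1) Q.ext_hom] by (simp add: StU_def)
      show "id \<in> hom (presented_group (stu_gens 4 L) (stu_rels bar act B)) ?G"
        by (simp add: hom_def StU_def)
      show "g \<in> carrier (presented_group (stu_gens 4 L) (stu_rels bar act B))"
        using g by (simp add: StU_def)
      fix x :: "('r, 'v) stu_gen" assume "x \<in> stu_gens 4 L"
      then show "(\<epsilon> \<circ> \<phi>) (word_class (stu_gens 4 L) (stu_rels bar act B) [(True, x)]) =
          id (word_class (stu_gens 4 L) (stu_rels bar act B) [(True, x)])"
        using \<phi>(2,3) by (cases x) (simp_all add: StU_X_def ext_W)
    qed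
    then show ?thesis by simp
  qed
  have "?K \<subseteq> ?N"
  proof
    fix x assume "x \<in> ?K"
    then have x: "x \<in> carrier U" "\<pi> x = \<one>\<^bsub>?G\<^esub>" by (simp_all add: kernel_def)
    have \<phi>\<pi>: "\<phi> \<circ> \<pi> \<in> hom U (U Mod ?N)"
      using hom_compose[OF U.ext_hom \<phi>(1)] .
    have "?q x = (\<phi> \<circ> \<pi>) x"
      by (rule universal_lift_unique[OF assms(3) \<epsilon>(1) q \<epsilon>(2) \<phi>\<pi> _ x(1)]) (simp_all add: retract)
    also have "\<dots> = \<one>\<^bsub>U Mod ?N\<^esub>"
      using x(2) hom_one[OF \<phi>(1)] Q.H.group_axioms F.group_axioms by simp
    finally have "?N #>\<^bsub>U\<^esub> x = ?N"
      by (simp add: FactGroup_def)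
    then show "x \<in> ?N"
      using U.H.rcos_self[OF x(1) N] by simp
  qed
  with sub show ?thesis
    unfolding C_def by blast
qed

end
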